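(* Let $0<p_1,p_2,q_1,q_2<\infty$, $p_1\ne q_1$, $p_2=q_2$ and $p_2\le p_1$. Let $v_1,v_2\in\mathcal W(0,\infty)$, $u_1\in{}^{\mathbf c}\Omega_{q_1}$ and $u_2\in\Omega_{q_2}$, and put $v(x)=v_1(x)^{-1}v_2(x)$. (i) If $q_1\le p_2$, then $$\|\mathrm I\|_{\mathrm{Cop}_{p_1,q_1}(u_1,v_1)\to\mathrm{Ces}_{p_2,q_2}(u_2,v_2)}\approx\sup_{t\in(0,\infty)}\|u_1\|_{q_1,(0,t)}^{-1}\,\Big\|\,\|u_2\|_{p_2,(\cdot,\infty)}\Big\|_{p_1\to p_2,v,(0,t)}.$$ (ii) If $p_2<q_1$, then $$\|\mathrm I\|_{\mathrm{Cop}_{p_1,q_1}(u_1,v_1)\to\mathrm{Ces}_{p_2,q_2}(u_2,v_2)}\approx\bigg(\int_0^\infty\Big\|\,\|u_2\|_{p_2,(\cdot,\infty)}\Big\|_{p_1\to p_2,v,(0,t)}^{q_1\to p_2}\,d\Big(-\|u_1\|_{q_1,(0,t)}^{-(q_1\to p_2)}\Big)\bigg)^{\frac1{q_1\to p_2}}+\|u_1\|_{q_1,(0,\infty)}^{-1}\Big\|\,\|u_2\|_{p_2,(\cdot,\infty)}\Big\|_{p_1\to p_2,v,(0,\infty)}.$$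
   Context: $\mathfrak M^+(0,\infty)$ is the set of non-negative measurable functions on $(0,\infty)$; $\mathcal W(0,\infty)$ is the set of weights (measurable functions, positive and finite a.e. on $(0,\infty)$). For $0<p\le\infty$ and measurable $A\subseteq(0,\infty)$, $\|f\|_{p,A}=(\int_A|f|^p\,dx)^{1/p}$ if $p<\infty$, $\|f\|_{\infty,A}=\operatorname{ess\,sup}_A|f|$, and $\|f\|_{p,w,A}=\|fw\|_{p,A}$. Conventions: $0/0=0$, $0\cdot(\pm\infty)=0$, $1/(\pm\infty)=0$. For $u\in\mathfrak M^+(0,\infty)$, $v\in\mathcal W(0,\infty)$ and $0<p,q\le\infty$, $\mathrm{Ces}_{p,q}(u,v)$ and $\mathrm{Cop}_{p,q}(u,v)$ are the sets of $f\in\mathfrak M^+(0,\infty)$ with finite $\|f\|_{\mathrm{Ces}_{p,q}(u,v)}=\big\|\,\|f\|_{p,v,(0,\cdot)}\big\|_{q,u,(0,\infty)}$, respectively $\|f\|_{\mathrm{Cop}_{p,q}(u,v)}=\big\|\,\|f\|_{p,v,(\cdot,\infty)}\big\|_{q,u,(0,\infty)}$. $\Omega_q$ is the set of $u\in\mathfrak M^+(0,\infty)$ with $0<\|u\|_{q,(t,\infty)}<\infty$ for all $t>0$; ${}^{\mathbf c}\Omega_q$ is the set of $u\in\mathfrak M^+(0,\infty)$ with $0<\|u\|_{q,(0,t)}<\infty$ for all $t>0$. $\|\mathrm I\|_{X\to Y}$ is the best constant of the embedding $X\hookrightarrow Y$: the least $c\in[0,\infty]$ with $\|f\|_Y\le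 c\|f\|_X$ for all $f\in X$. For $0<p,q\le\infty$, $p\to q$ denotes the number given by $\frac1{p\to q}=\frac1q-\frac1p$ if $q<p$, and $p\to q=\infty$ if $q\ge p$. For non-decreasing $h$ on $(0,\infty)$, $\int f\,dh$ is the Lebesgue–Stieltjes integral. $A\approx B$ means $c^{-1}B\le A\le cB$ with a constant $c>0$ depending only on $p_1,p_2,q_1,q_2$. *)

theory Defs
  imports "HOL-Analysis.Analysis" "HOL-Probability.Essential_Supremum"
begin

text \<open>
  Non-negative functions on \<open>(0,\<infinity>)\<close> are modelled as \<open>real \<Rightarrow> ennreal\<close>; values outside
  \<open>(0,\<infinity>)\<close> are never inspected. On \<open>ennreal\<close> the conventions \<open>0 / 0 = 0\<close>, \<open>0 * \<infinity> = 0\<close>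
  and \<open>1 / \<infinity> = 0\<close> hold. Exponents in \<open>(0,\<infinity>]\<close> are also elements of \<open>ennreal\<close>.
\<close>

definition Mplus :: "(real \<Rightarrow> ennreal) set" where
  "Mplus = borel_measurable (lebesgue_on {0<..})"

definition weights :: "(real \<Rightarrow> ennreal) set" where
  "weights = {w \<in> Mplus. AE x in lebesgue_on {0<..}. 0 < w x \<and> w x < \<infinity>}"

text \<open>Real powers on \<open>[0,\<infinity>]\<close>, only meant for exponents \<open>r > 0\<close>.\<close>

definition epowr :: "ennreal \<Rightarrow> real \<Rightarrow> ennreal" where
  "epowr x r = (if x = \<infinity> then \<infinity> else ennreal (enn2real x powr r))"

definition Lnorm :: "ennreal \<Rightarrow> real set \<Rightarrow> (real \<Rightarrow> ennreal) \<Rightarrow> ennreal" where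
  "Lnorm p A f =
    (if p = \<infinity> then esssup (lebesgue_on A) f
     else epowr (\<integral>\<^sup>+x. epowr (f x) (enn2real p) \<partial>lebesgue_on A) (1 / enn2real p))"

definition wLnorm :: "ennreal \<Rightarrow> (real \<Rightarrow> ennreal) \<Rightarrow> real set \<Rightarrow> (real \<Rightarrow> ennreal) \<Rightarrow> ennreal" where
  "wLnorm p w A f = Lnorm p A (\<lambda>x. f x * w x)"

definition Ces_norm ::
  "ennreal \<Rightarrow> ennreal \<Rightarrow> (real \<Rightarrow> ennreal) \<Rightarrow> (real \<Rightarrow> ennreal) \<Rightarrow> (real \<Rightarrow> ennreal) \<Rightarrow> ennreal" where
  "Ces_norm p q u v f = wLnorm q u {0<..} (\<lambda>x. wLnorm p v {0<..<x} f)"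

definition Cop_norm ::
  "ennreal \<Rightarrow> ennreal \<Rightarrow> (real \<Rightarrow> ennreal) \<Rightarrow> (real \<Rightarrow> ennreal) \<Rightarrow> (real \<Rightarrow> ennreal) \<Rightarrow> ennreal" where
  "Cop_norm p q u v f = wLnorm q u {0<..} (\<lambda>x. wLnorm p v {x<..} f)"

text \<open>
  The least \<open>c \<in> [0,\<infinity>]\<close> in the embedding inequality, where the source space consists of the
  functions in \<^const>\<open>Mplus\<close> with finite norm \<open>NX\<close>. The infimum is \<open>\<infinity>\<close> if no constant works.
\<close>

definition embedding_const ::
  "((real \<Rightarrow> ennreal) \<Rightarrow> ennreal) \<Rightarrow> ((real \<Rightarrow> ennreal) \<Rightarrow> ennreal) \<Rightarrow> ennreal" where
  "embedding_const NX NY = Inf {c. \<forall>f\<in>{f \<in> Mplus. NX f < \<infinity>}. NY f \<le> c * NX f}"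

definition Omega :: "ennreal \<Rightarrow> (real \<Rightarrow> ennreal) set" where
  "Omega q = {u \<in> Mplus. \<forall>t>0. 0 < Lnorm q {t<..} u \<and> Lnorm q {t<..} u < \<infinity>}"

definition cOmega :: "ennreal \<Rightarrow> (real \<Rightarrow> ennreal) set" where
  "cOmega q = {u \<in> Mplus. \<forall>t>0. 0 < Lnorm q {0<..<t} u \<and> Lnorm q {0<..<t} u < \<infinity>}"

text \<open>The exponent \<open>p \<rightarrow> q\<close>.\<close>

definition exp_to :: "ennreal \<Rightarrow> ennreal \<Rightarrow> ennreal" where
  "exp_to p q = (if q < p then 1 / (1 / q - 1 / p) else \<infinity>)"

text \<open>
  The Lebesgue--Stieltjes measure on \<open>(0,\<infinity>)\<close> of a non-decreasing function \<open>h\<close>, that is,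
  \<open>(a,b] \<mapsto> h(b+) - h(a+)\<close> for \<open>0 < a \<le> b\<close>. Since \<open>h\<close> may be unbounded below near \<open>0\<close>, it cannot
  be extended monotonically to the whole line; instead the library's construction on the line
  is applied to \<open>h \<circ> exp\<close> and transported back along \<open>exp\<close>.
\<close>

definition stieltjes :: "(real \<Rightarrow> real) \<Rightarrow> real measure" where
  "stieltjes h =
    distr (interval_measure (\<lambda>s. Lim (at_right (exp s)) h)) (restrict_space borel {0<..}) exp"

lemma emeasure_stieltjes_Ioc:
  assumes mono: "mono_on {0<..} h"
    and rc: "\<And>t. 0 < t \<Longrightarrow> continuous (at_right t) h"
    and ab: "0 < a" "a \<le> b"
  shows "emeasure (stieltjes h) {a<..b} = ennreal (h b - h a)"
proof -
  have eq: "(\<lambda>s. Lim (at_right (exp s)) h) = (\<lambda>s. h (exp s))"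
    using rc by (auto intro!: ext tendsto_Lim simp: continuous_within)
  have cont: "continuous (at_right s) (\<lambda>s. h (exp s))" for s :: real
  proof -
    have "filterlim exp (at_right (exp s)) (at_right s)"
      unfolding filterlim_at
      by (auto intro!: tendsto_intros eventually_at_right_less[THEN eventually_mono])
    then show ?thesis
      using rc[of "exp s"] unfolding continuous_within
      by (auto intro: filterlim_compose)
  qed
  have meas: "exp \<in> measurable (interval_measure F) (restrict_space borel {0::real<..})" for F
    by (auto intro!: measurable_restrict_space2 simp: measurable_cong_sets[OF sets_interval_measure refl])
  have vim: "exp -` {a<..b} = {ln a<..ln b}"
    using ab by (auto simp: ln_ge_iff) (metis exp_less_cancel_iff exp_ln)+
  have sets: "{a<..b} \<in> sets (restrict_space borel {0::real<..})"
    using ab by (subst sets_restrict_space_iff) auto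
  have "emeasure (stieltjes h) {a<..b} = emeasure (interval_measure (\<lambda>s. h (exp s))) {ln a<..ln b}"
    unfolding stieltjes_def eq by (subst emeasure_distr[OF meas sets]) (simp add: vim)
  also have "\<dots> = ennreal (h (exp (ln b)) - h (exp (ln a)))"
    using ab by (intro emeasure_interval_measure_Ioc cont) (auto intro!: mono_onD[OF mono])
  finally show ?thesis using ab by simp
qed

definition equiv_up_to :: "real \<Rightarrow> ennreal \<Rightarrow> ennreal \<Rightarrow> bool" where
  "equiv_up_to c A B \<longleftrightarrow> ennreal (1 / c) * B \<le> A \<and> A \<le> ennreal c * B"

end

(*
  With p = p2 = q2, P = p1/p, Q = q1/p, F = (f v1)^p, U = u1^q1 and W = (v U2)^p, where
  U2(x) is the norm of u2 over (x,oo), Tonelli turns the target norm into (int F W)^(1/p),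
  while the source norm is a power of int U(x) (int_x^oo F^P)^(Q/P) dx.
  Cut (0,b] at points x_k with V(x_k) = V(b) l^-k, V being the primitive of U. Hoelder's
  inequality on each cell together with sum a_k^Q >= (sum a_k)^Q for Q <= 1, or Hoelder's
  inequality for series for Q > 1, gives the upper bounds. Conversely, functions supported in
  (0,t) give a single-interval lower bound, and for Q > 1 one tests with a sum of nearly
  extremal functions on the cells. Taking l = 4^Q makes the two sums of Hardy type that arise
  there absorbable into themselves.
*)

theory Submission
  imports Defs
begin

section \<open>Powers of extended non-negative reals\<close>

text \<open>With s = 1/(Q-1), the number Q s is the exponent conjugate to Q and q1 \<rightarrow> p2
  = q1 s; likewise p1 \<rightarrow> p2 is p2 times the exponent conjugate to P. The local norm over
  (0,t) in the statement is the norm of the functional given by integration against W on the unit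
  ball of L^P(0,t), raised to 1/p2. It is kept as a supremum until the end, which treats P = 1 and P
  > 1 together and makes monotonicity and subadditivity in the set immediate. V may stay bounded,
  and then no geometric sequence of V-levels exhausts (0,oo). Hence every grid starts at an
  arbitrary b and descends to 0, the constants are free of b, and b tends to infinity last. The
  boundary term in (ii) has its origin here: the Stieltjes measure of -V^(-s) gives (b,oo) only the
  mass V(b)^(-s) - V(oo)^(-s), and the missing part at the first grid point is paid by that term.
  Since quantities range over [0,oo], absorption and division need finiteness. The lower bound
  therefore uses finite truncations and takes finiteness of the local norms from the single-interval
  bound.\<close>

lemma epowr_zero [simp]: "epowr 0 r = 0"
  and epowr_one [simp]: "epowr 1 r = 1"
  and epowr_top [simp]: "epowr top r = top"
  by (simp_all add: epowr_def)

lemma epowr_ennreal: "0 \<le> x \<Longrightarrow> epowr (ennreal x) r = ennreal (x powr r)"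
  by (simp add: epowr_def)

lemma epowr_exp_one [simp]: "epowr a 1 = a"
  by (cases a) (auto simp: epowr_def)

lemma epowr_eq_0_iff [simp]: "epowr a r = 0 \<longleftrightarrow> a = 0"
  by (cases a) (auto simp: epowr_def)

lemma epowr_eq_top_iff [simp]: "epowr a r = top \<longleftrightarrow> a = top"
  by (cases a) (auto simp: epowr_def)

lemma epowr_less_top_iff [simp]: "epowr a r < top \<longleftrightarrow> a < top"
  by (simp add: less_top[symmetric])

lemma epowr_mono: "0 \<le> r \<Longrightarrow> a \<le> b \<Longrightarrow> epowr a r \<le> epowr b r"
  by (cases a; cases b) (auto simp: epowr_ennreal top_unique intro!: powr_mono2)

lemma epowr_mult: "epowr (a * b) r = epowr a r * epowr b r"
  by (cases a; cases b)
    (auto simp: epowr_ennreal powr_mult ennreal_mult[symmetric] ennreal_mult_top ennreal_top_mult)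

lemma epowr_epowr: "epowr (epowr a r) s = epowr a (r * s)"
  by (cases a) (auto simp: epowr_ennreal powr_powr)

lemma epowr_add: "epowr a (r + s) = epowr a r * epowr a s"
  by (cases a) (auto simp: epowr_ennreal powr_add ennreal_mult)

lemma epowr_inverse: "epowr (inverse a) r = inverse (epowr a r)"
proof (cases a)
  case (real x)
  then show ?thesis
    by (cases "x = 0") (auto simp: epowr_ennreal inverse_ennreal powr_minus inverse_powr)
qed simp

lemma epowr_le_iff:
  assumes "0 < r" shows "epowr a r \<le> epowr b r \<longleftrightarrow> a \<le> b"
proof
  assume "epowr a r \<le> epowr b r"
  then have "epowr (epowr a r) (1 / r) \<le> epowr (epowr b r) (1 / r)"
    using assms by (intro epowr_mono[where r = "1 / r"]) auto
  then show "a \<le> b" using assms by (simp add: epowr_epowr)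
qed (use assms in \<open>simp add: epowr_mono\<close>)

lemma epowr_le_swap: "0 < r \<Longrightarrow> epowr a r \<le> b \<longleftrightarrow> a \<le> epowr b (1 / r)"
  using epowr_le_iff[of r a "epowr b (1 / r)"] by (simp add: epowr_epowr)

lemma le_epowr_swap: "0 < r \<Longrightarrow> a \<le> epowr b r \<longleftrightarrow> epowr a (1 / r) \<le> b"
  using epowr_le_iff[of r "epowr a (1 / r)" b] by (simp add: epowr_epowr)

lemma measurable_epowr [measurable]:
  "f \<in> borel_measurable M \<Longrightarrow> (\<lambda>x. epowr (f x) r) \<in> borel_measurable M"
proof -
  assume [measurable]: "f \<in> borel_measurable M"
  have [measurable]: "{x \<in> space M. f x = \<infinity>} \<in> sets M"
    using measurable_sets[of f M borel "{\<infinity>}"] by (simp add: vimage_def Int_def conj_commute)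
  show ?thesis unfolding epowr_def by measurable
qed

lemma ennreal_mult_inverse_cancel:
  assumes "0 < a" "a < top" shows "a * (inverse a * b) = (b::ennreal)"
proof -
  have "a * inverse a = 1"
    using assms by (cases a) (auto simp: inverse_ennreal simp flip: ennreal_mult)
  then show ?thesis by (simp flip: mult.assoc)
qed

lemma ennreal_inverse_inverse [simp]: "inverse (inverse a) = (a::ennreal)"
proof (cases a)
  case (real x)
  then show ?thesis by (cases "x = 0") (auto simp: inverse_ennreal)
qed simp

lemma ennreal_inverse_antimono:
  assumes "a \<le> (b::ennreal)" shows "inverse b \<le> inverse a"
proof (cases a)
  case a: (real x)
  show ?thesis
  proof (cases b)
    case b: (real y)
    show ?thesis
    proof (cases "x = 0")
      case False
      then have "0 < x" "x \<le> y" using assms a b by auto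
      then show ?thesis using a b by (simp add: inverse_ennreal le_imp_inverse_le ennreal_leI)
    qed (use a in simp)
  qed simp
qed (use assms in \<open>simp add: top_unique\<close>)

lemma epowr_add_le:
  assumes "0 \<le> r" shows "epowr (a + b) r \<le> ennreal (2 powr r) * (epowr a r + epowr b r)"
proof -
  have "epowr (a + b) r \<le> epowr (2 * max a b) r"
    using assms by (intro epowr_mono) (auto simp: mult_2 intro: add_mono)
  also have "\<dots> = ennreal (2 powr r) * epowr (max a b) r"
    using epowr_ennreal[of 2 r] by (simp add: epowr_mult)
  also have "\<dots> \<le> ennreal (2 powr r) * (epowr a r + epowr b r)"
    by (intro mult_left_mono) (auto simp: max_def)
  finally show ?thesis .
qed

text \<open>Factor a^r = a^(r-1) a: since r - 1 is non-negative, both a^(r-1) and b^(r-1) are at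
  most (a+b)^(r-1).\<close>

lemma epowr_superadd:
  assumes "1 \<le> r" shows "epowr a r + epowr b r \<le> epowr (a + b) r"
proof -
  have *: "epowr x r = epowr x (r - 1) * x" for x
    using epowr_add[of x "r - 1" 1] by simp
  show ?thesis
    unfolding *[of a] *[of b] *[of "a + b"] distrib_left
    using assms by (intro add_mono mult_right_mono epowr_mono) auto
qed

lemma sum_epowr_le:
  assumes "1 \<le> r" "finite I"
  shows "(\<Sum>i\<in>I. epowr (f i) r) \<le> epowr (\<Sum>i\<in>I. f i) r"
  using assms(2)
proof induction
  case (insert i I)
  then have "(\<Sum>i\<in>insert i I. epowr (f i) r) \<le> epowr (f i) r + epowr (\<Sum>i\<in>I. f i) r"
    by (simp add: add_left_mono)
  also have "\<dots> \<le> epowr (\<Sum>i\<in>insert i I. f i) r"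
    using insert epowr_superadd[OF assms(1)] by simp
  finally show ?case .
qed simp

text \<open>Superadditivity for the exponent 1/r, applied to the terms f(i)^r, bounds every partial
  sum; the supremum over n gives the series.\<close>

lemma epowr_suminf_le:
  assumes "0 < r" "r \<le> 1"
  shows "epowr (\<Sum>i. f i) r \<le> (\<Sum>i. epowr (f i) r)"
proof -
  have "sum f {..<n} \<le> epowr (\<Sum>i. epowr (f i) r) (1 / r)" for n
  proof -
    have "sum f {..<n} = (\<Sum>i<n. epowr (epowr (f i) r) (1 / r))"
      using assms by (simp add: epowr_epowr)
    also have "\<dots> \<le> epowr (\<Sum>i<n. epowr (f i) r) (1 / r)"
      using assms by (intro sum_epowr_le) auto
    also have "\<dots> \<le> epowr (\<Sum>i. epowr (f i) r) (1 / r)"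
      using assms by (intro epowr_mono sum_le_suminf) auto
    finally show ?thesis .
  qed
  then show ?thesis
    unfolding epowr_le_swap[OF assms(1)] suminf_eq_SUP by (auto intro: SUP_least)
qed

section \<open>Hoelder's inequality\<close>

lemma ennreal_Young:
  assumes "1 < p" "1 < q" "1 / p + 1 / q = 1"
  shows "a * b \<le> ennreal (1 / p) * epowr a p + ennreal (1 / q) * epowr b q"
proof (cases "a = \<infinity> \<or> b = \<infinity>")
  case True
  then show ?thesis using assms by (auto simp: ennreal_mult_top)
next
  case False
  then obtain x y where xy: "a = ennreal x" "b = ennreal y" "0 \<le> x" "0 \<le> y"
    by (metis ennreal_cases infinity_ennreal_def)
  have "x * y \<le> x powr p / p + y powr q / q"
    using Youngs_inequality[of p q x y] assms xy by auto
  then show ?thesis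
    using assms xy by (simp add: epowr_ennreal flip: ennreal_mult ennreal_plus)
qed

text \<open>Young's inequality for F and G normalised to norm one. Norms equal to 0 or oo cannot be
  normalised and are settled beforehand: a vanishing one forces f g = 0 a.e., and otherwise an
  infinite one makes the right-hand side infinite.\<close>

lemma nn_integral_Hoelder:
  assumes pq: "1 < p" "1 < q" "1 / p + 1 / q = 1"
    and [measurable]: "f \<in> borel_measurable M" "g \<in> borel_measurable M"
  shows "(\<integral>\<^sup>+x. f x * g x \<partial>M) \<le>
    epowr (\<integral>\<^sup>+x. epowr (f x) p \<partial>M) (1 / p) * epowr (\<integral>\<^sup>+x. epowr (g x) q \<partial>M) (1 / q)"
    (is "_ \<le> ?a * ?b")
proof -
  have ap: "epowr ?a p = (\<integral>\<^sup>+x. epowr (f x) p \<partial>M)" and bq: "epowr ?b q = (\<integral>\<^sup>+x. epowr (g x) q \<partial>M)"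
    using pq by (auto simp: epowr_epowr)
  consider "?a = 0 \<or> ?b = 0" | "?a \<noteq> 0" "?b \<noteq> 0" "?a = \<infinity> \<or> ?b = \<infinity>"
    | "0 < ?a" "?a < \<infinity>" "0 < ?b" "?b < \<infinity>"
    by (metis infinity_ennreal_def top.not_eq_extremum not_gr_zero)
  then show ?thesis
  proof cases
    case 1
    then have "AE x in M. f x * g x = 0"
      by (auto simp: nn_integral_0_iff_AE)
    then have "(\<integral>\<^sup>+x. f x * g x \<partial>M) = 0" by (subst nn_integral_0_iff_AE) auto
    then show ?thesis by simp
  next
    case 2
    then have "?a * ?b = \<infinity>" by (auto simp: ennreal_mult_eq_top_iff)
    then show ?thesis by simp
  next
    case 3
    have norm: "(\<integral>\<^sup>+x. epowr (inverse c * h x) r \<partial>M) = 1"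
      if [measurable]: "h \<in> borel_measurable M"
        and "0 < c" "c < \<infinity>" "epowr c r = (\<integral>\<^sup>+x. epowr (h x) r \<partial>M)" for c h r
    proof -
      have "(\<integral>\<^sup>+x. epowr (inverse c * h x) r \<partial>M) = inverse (epowr c r) * epowr c r"
        by (simp add: epowr_mult epowr_inverse nn_integral_cmult that)
      also have "\<dots> = 1"
        using that(2,3) ennreal_mult_inverse_cancel[of "epowr c r" 1]
        by (simp add: mult.commute zero_less_iff_neq_zero)
      finally show ?thesis .
    qed
    define F G where "F x = inverse ?a * f x" and "G x = inverse ?b * g x" for x
    have [measurable]: "F \<in> borel_measurable M" "G \<in> borel_measurable M"
      unfolding F_def[abs_def] G_def[abs_def] by measurable
    have fg: "f x * g x = ?a * ?b * (F x * G x)" for x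
    proof -
      have "?a * ?b * (F x * G x) = (?a * (inverse ?a * f x)) * (?b * (inverse ?b * g x))"
        unfolding F_def G_def by (simp only: ac_simps)
      then show ?thesis using 3 by (simp only: ennreal_mult_inverse_cancel infinity_ennreal_def)
    qed
    have "(\<integral>\<^sup>+x. F x * G x \<partial>M)
       \<le> (\<integral>\<^sup>+x. ennreal (1 / p) * epowr (F x) p + ennreal (1 / q) * epowr (G x) q \<partial>M)"
      by (intro nn_integral_mono ennreal_Young pq)
    also have "\<dots> = ennreal (1 / p) * (\<integral>\<^sup>+x. epowr (F x) p \<partial>M)
        + ennreal (1 / q) * (\<integral>\<^sup>+x. epowr (G x) q \<partial>M)"
      by (simp add: nn_integral_add nn_integral_cmult)
    also have "\<dots> = 1"
      using norm[OF _ 3(1,2) ap] norm[OF _ 3(3,4) bq] pq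
      by (simp add: F_def[abs_def] G_def[abs_def] flip: ennreal_plus)
    finally have "?a * ?b * (\<integral>\<^sup>+x. F x * G x \<partial>M) \<le> ?a * ?b * 1"
      by (rule mult_left_mono) simp
    then show ?thesis
      unfolding fg by (simp add: nn_integral_cmult)
  qed
qed

lemma suminf_Hoelder:
  fixes f g :: "nat \<Rightarrow> ennreal"
  assumes "1 < p" "1 < q" "1 / p + 1 / q = 1"
  shows "(\<Sum>i. f i * g i) \<le> epowr (\<Sum>i. epowr (f i) p) (1 / p) * epowr (\<Sum>i. epowr (g i) q) (1 / q)"
  using nn_integral_Hoelder[OF assms, of f "count_space UNIV" g]
  by (simp add: nn_integral_count_space_nat)

section \<open>Dual norms\<close>

abbreviation Lpos :: "real measure" where "Lpos \<equiv> lebesgue_on {0<..}"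

lemma measurable_ident_lebesgue_on [measurable]: "(\<lambda>x. x) \<in> borel_measurable (lebesgue_on S)"
  by (simp add: borel_measurable_if_I measurable_completion measurable_restrict_space1)

text \<open>The norm of the functional f -> int_A f w on the unit ball of L^p(A). The set enters
  through an indicator and not through the measure, so that all functions live on one measure space
  while A varies.\<close>

definition dual_norm :: "'a measure \<Rightarrow> real \<Rightarrow> ('a \<Rightarrow> ennreal) \<Rightarrow> 'a set \<Rightarrow> ennreal" where
  "dual_norm M p w A =
    (SUP f\<in>{f \<in> borel_measurable M. (\<integral>\<^sup>+x. epowr (f x) p * indicator A x \<partial>M) \<le> 1}.
       \<integral>\<^sup>+x. f x * w x * indicator A x \<partial>M)"

lemma dual_norm_upper:
  assumes "f \<in> borel_measurable M" "(\<integral>\<^sup>+x. epowr (f x) p * indicator A x \<partial>M) \<le> 1"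
  shows "(\<integral>\<^sup>+x. f x * w x * indicator A x \<partial>M) \<le> dual_norm M p w A"
  unfolding dual_norm_def by (rule SUP_upper) (use assms in auto)

text \<open>Normalise f to the unit ball and scale back. If its norm is 0, then f vanishes a.e. on A
  and there is nothing to divide by; finiteness permits the division otherwise.\<close>

lemma dual_norm_Hoelder:
  assumes p: "0 < p" and [measurable]: "f \<in> borel_measurable M" "w \<in> borel_measurable M"
    "Measurable.pred M (\<lambda>x. x \<in> A)"
    and fin: "(\<integral>\<^sup>+x. epowr (f x) p * indicator A x \<partial>M) < top"
  shows "(\<integral>\<^sup>+x. f x * w x * indicator A x \<partial>M) \<le>
    epowr (\<integral>\<^sup>+x. epowr (f x) p * indicator A x \<partial>M) (1 / p) * dual_norm M p w A"
    (is "_ \<le> epowr ?I _ * _")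
proof (cases "?I = 0")
  case True
  then have "AE x in M. epowr (f x) p * indicator A x = 0"
    by (subst (asm) nn_integral_0_iff_AE) auto
  then have "AE x in M. f x * w x * indicator A x = 0"
    by eventually_elim auto
  then have "(\<integral>\<^sup>+x. f x * w x * indicator A x \<partial>M) = 0"
    by (subst nn_integral_0_iff_AE) auto
  then show ?thesis by simp
next
  case False
  define c where "c = epowr ?I (1 / p)"
  have c: "0 < c" "c < top" "epowr c p = ?I"
    using False fin p by (auto simp: c_def epowr_epowr zero_less_iff_neq_zero)
  have "(\<integral>\<^sup>+x. epowr (inverse c * f x) p * indicator A x \<partial>M) =
      (\<integral>\<^sup>+x. inverse ?I * (epowr (f x) p * indicator A x) \<partial>M)"
    by (simp add: epowr_mult epowr_inverse c mult.assoc)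
  also have "\<dots> = inverse ?I * ?I" by (rule nn_integral_cmult) measurable
  also have "\<dots> = 1"
    using ennreal_mult_inverse_cancel[of ?I 1] False fin
    by (simp add: mult.commute zero_less_iff_neq_zero)
  finally have "(\<integral>\<^sup>+x. (inverse c * f x) * w x * indicator A x \<partial>M) \<le> dual_norm M p w A"
    by (intro dual_norm_upper) auto
  then have "c * (\<integral>\<^sup>+x. (inverse c * f x) * w x * indicator A x \<partial>M) \<le> c * dual_norm M p w A"
    by (rule mult_left_mono) simp
  also have "c * (\<integral>\<^sup>+x. (inverse c * f x) * w x * indicator A x \<partial>M)
      = (\<integral>\<^sup>+x. c * (inverse c * (f x * w x * indicator A x)) \<partial>M)"
    by (subst nn_integral_cmult[symmetric]) (auto simp: mult.assoc)
  also have "\<dots> = (\<integral>\<^sup>+x. f x * w x * indicator A x \<partial>M)"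
    using c by (simp add: ennreal_mult_inverse_cancel)
  finally show ?thesis by (simp add: c_def)
qed

lemma dual_norm_mono:
  assumes [measurable]: "Measurable.pred M (\<lambda>x. x \<in> A)" and "A \<subseteq> B"
  shows "dual_norm M p w A \<le> dual_norm M p w B"
  unfolding dual_norm_def[of M p w A]
proof (rule SUP_least, clarify)
  fix f :: "'a \<Rightarrow> ennreal"
  assume [measurable]: "f \<in> borel_measurable M" and f: "(\<integral>\<^sup>+x. epowr (f x) p * indicator A x \<partial>M) \<le> 1"
  let ?g = "\<lambda>x. f x * indicator A x"
  have "(\<integral>\<^sup>+x. f x * w x * indicator A x \<partial>M) = (\<integral>\<^sup>+x. ?g x * w x * indicator B x \<partial>M)"
    using assms(2) by (intro nn_integral_cong) (auto simp: indicator_def)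
  also have "\<dots> \<le> dual_norm M p w B"
  proof (rule dual_norm_upper)
    have "(\<integral>\<^sup>+x. epowr (?g x) p * indicator B x \<partial>M) = (\<integral>\<^sup>+x. epowr (f x) p * indicator A x \<partial>M)"
      using assms(2) by (intro nn_integral_cong) (auto simp: indicator_def)
    then show "(\<integral>\<^sup>+x. epowr (?g x) p * indicator B x \<partial>M) \<le> 1" using f by simp
  qed simp
  finally show "(\<integral>\<^sup>+x. f x * w x * indicator A x \<partial>M) \<le> dual_norm M p w B" .
qed

lemma dual_norm_cong_AE:
  assumes "AE x in M. x \<in> A \<longleftrightarrow> x \<in> B"
  shows "dual_norm M p w A = dual_norm M p w B"
proof -
  have "(\<integral>\<^sup>+x. g x * indicator A x \<partial>M) = (\<integral>\<^sup>+x. g x * indicator B x \<partial>M)" for g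
    using assms by (intro nn_integral_cong_AE) (auto simp: indicator_def)
  then show ?thesis by (simp add: dual_norm_def)
qed

text \<open>Restricting a competitor on the union to either piece does not increase its norm, so one
  f competes for both suprema at once.\<close>

lemma dual_norm_Un:
  assumes p: "0 < p" and [measurable]: "w \<in> borel_measurable M" "Measurable.pred M (\<lambda>x. x \<in> A)"
    "Measurable.pred M (\<lambda>x. x \<in> B)" and "A \<inter> B = {}"
  shows "dual_norm M p w (A \<union> B) \<le> dual_norm M p w A + dual_norm M p w B"
  unfolding dual_norm_def[of M p w "A \<union> B"]
proof (rule SUP_least, clarify)
  fix f :: "'a \<Rightarrow> ennreal"
  assume [measurable]: "f \<in> borel_measurable M"
    and f: "(\<integral>\<^sup>+x. epowr (f x) p * indicator (A \<union> B) x \<partial>M) \<le> 1"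
  have *: "(\<integral>\<^sup>+x. f x * w x * indicator E x \<partial>M) \<le> dual_norm M p w E" if "E \<subseteq> A \<union> B" for E
  proof (rule dual_norm_upper)
    have "(\<integral>\<^sup>+x. epowr (f x) p * indicator E x \<partial>M) \<le> (\<integral>\<^sup>+x. epowr (f x) p * indicator (A \<union> B) x \<partial>M)"
      using that by (intro nn_integral_mono) (auto simp: indicator_def)
    with f show "(\<integral>\<^sup>+x. epowr (f x) p * indicator E x \<partial>M) \<le> 1" by simp
  qed simp
  have "(\<integral>\<^sup>+x. f x * w x * indicator (A \<union> B) x \<partial>M)
      = (\<integral>\<^sup>+x. f x * w x * indicator A x + f x * w x * indicator B x \<partial>M)"
    using assms(5) by (intro nn_integral_cong) (auto simp: indicator_def)
  also have "\<dots> = (\<integral>\<^sup>+x. f x * w x * indicator A x \<partial>M) + (\<integral>\<^sup>+x. f x * w x * indicator B x \<partial>M)"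
    by (rule nn_integral_add) measurable
  also have "\<dots> \<le> dual_norm M p w A + dual_norm M p w B"
    by (intro add_mono *) auto
  finally show "(\<integral>\<^sup>+x. f x * w x * indicator (A \<union> B) x \<partial>M) \<le> dual_norm M p w A + dual_norm M p w B" .
qed

lemma AE_Lpos_Ioc_Ioo: "AE x in Lpos. x \<in> {a<..b} \<longleftrightarrow> x \<in> {a<..<b}"
proof -
  have "AE x in lebesgue. x \<noteq> b"
    by (rule AE_completion) (simp add: AE_lborel_singleton)
  then have "AE x in Lpos. x \<noteq> b"
    by (auto simp: AE_restrict_space_iff)
  then show ?thesis by eventually_elim auto
qed

text \<open>Exhaustion by (0,n] and monotone convergence. The measure is left general because both
  Lebesgue measure and the Stieltjes measures on (0,oo) occur.\<close>

lemma nn_integral_le_if_bounded_parts: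
  fixes M :: "real measure"
  assumes [measurable]: "f \<in> borel_measurable M" "(\<lambda>x. x) \<in> borel_measurable M"
    and sp: "space M \<subseteq> {0<..}"
    and le: "\<And>b. 0 < b \<Longrightarrow> (\<integral>\<^sup>+x. f x * indicator {0<..b} x \<partial>M) \<le> K"
  shows "(\<integral>\<^sup>+x. f x \<partial>M) \<le> K"
proof -
  have "(\<integral>\<^sup>+x. f x \<partial>M) = (\<integral>\<^sup>+x. (SUP n. f x * indicator {0<..real (Suc n)} x) \<partial>M)"
  proof (rule nn_integral_cong)
    fix x assume "x \<in> space M"
    then have "0 < x" using sp by auto
    obtain n where "x \<le> real (Suc n)" by (metis le_Suc_eq nat_le_real_less real_arch_simple of_nat_le_iff order.trans)
    show "f x = (SUP n. f x * indicator {0<..real (Suc n)} x)"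
    proof (rule antisym)
      show "f x \<le> (SUP n. f x * indicator {0<..real (Suc n)} x)"
        by (rule SUP_upper2[of n]) (use \<open>0 < x\<close> \<open>x \<le> real (Suc n)\<close> in auto)
    qed (auto intro!: SUP_least simp: indicator_def)
  qed
  also have "\<dots> = (SUP n. \<integral>\<^sup>+x. f x * indicator {0<..real (Suc n)} x \<partial>M)"
    by (intro nn_integral_monotone_convergence_SUP)
      (auto simp: incseq_def le_fun_def indicator_def)
  also have "\<dots> \<le> K"
    by (intro SUP_least le) simp
  finally show ?thesis .
qed

section \<open>Discretisation along the primitive of the weight\<close>

locale copson_weight =
  fixes U :: "real \<Rightarrow> ennreal"
  assumes U_measurable [measurable]: "U \<in> borel_measurable Lpos"
    and U_pos: "0 < t \<Longrightarrow> 0 < (\<integral>\<^sup>+x. U x * indicator {0<..<t} x \<partial>Lpos)"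
    and U_finite: "0 < t \<Longrightarrow> (\<integral>\<^sup>+x. U x * indicator {0<..<t} x \<partial>Lpos) < top"
begin

definition V :: "real \<Rightarrow> real" where
  "V t = enn2real (\<integral>\<^sup>+x. U x * indicator {0<..<t} x \<partial>Lpos)"

lemma V_nonpos: "t \<le> 0 \<Longrightarrow> V t = 0"
proof -
  assume "t \<le> 0"
  then have "{0<..<t} = {}" by auto
  then show ?thesis by (simp add: V_def)
qed

lemma nn_integral_Ioo: "(\<integral>\<^sup>+x. U x * indicator {0<..<t} x \<partial>Lpos) = ennreal (V t)"
proof -
  have "(\<integral>\<^sup>+x. U x * indicator {0<..<t} x \<partial>Lpos) < top"
    using U_finite[of t] by (cases "0 < t") auto
  then show ?thesis by (simp add: V_def)
qed

lemma V_pos: "0 < t \<Longrightarrow> 0 < V t"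
  using U_pos[of t] by (simp add: nn_integral_Ioo)

lemma V_nonneg [simp]: "0 \<le> V t"
  by (simp add: V_def)

lemma nn_integral_Ioc_0: "(\<integral>\<^sup>+x. U x * indicator {0<..t} x \<partial>Lpos) = ennreal (V t)"
  unfolding nn_integral_Ioo[symmetric] using AE_Lpos_Ioc_Ioo[of 0 t]
  by (intro nn_integral_cong_AE) (auto simp: indicator_def)

lemma V_add:
  assumes "0 \<le> a" "a \<le> b"
  shows "ennreal (V b) = ennreal (V a) + (\<integral>\<^sup>+x. U x * indicator {a<..b} x \<partial>Lpos)"
proof -
  have "ennreal (V b) = (\<integral>\<^sup>+x. U x * indicator {0<..a} x + U x * indicator {a<..b} x \<partial>Lpos)"
    unfolding nn_integral_Ioc_0[symmetric] using assms
    by (intro nn_integral_cong) (auto simp: indicator_def)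
  then show ?thesis by (simp add: nn_integral_add nn_integral_Ioc_0)
qed

lemma V_mono: "a \<le> b \<Longrightarrow> V a \<le> V b"
proof (cases "0 \<le> a")
  assume "a \<le> b" "0 \<le> a"
  then have "ennreal (V a) \<le> ennreal (V b)" using V_add[of a b] by simp
  then show ?thesis by (simp add: ennreal_le_iff)
qed (simp add: V_nonpos)

lemma nn_integral_Ioc:
  assumes "0 \<le> a" "a \<le> b"
  shows "(\<integral>\<^sup>+x. U x * indicator {a<..b} x \<partial>Lpos) = ennreal (V b - V a)"
  using V_add[OF assms] by (metis V_nonneg ennreal_add_diff_cancel_left ennreal_minus ennreal_neq_top)

text \<open>Dominated convergence with majorant U on (0,T). The point 0 is included on purpose: V(0)
  = 0 lets the intermediate value theorem reach every small positive level.\<close>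

lemma continuous_on_V: "continuous_on {0..<T} V"
  unfolding continuous_on_sequentially
proof clarify
  fix x :: "nat \<Rightarrow> real" and a
  assume a: "a \<in> {0..<T}" and x: "\<forall>n. x n \<in> {0..<T}" "x \<longlonglongrightarrow> a"
  have "(\<lambda>n. \<integral>\<^sup>+y. U y * indicator {0<..<x n} y \<partial>Lpos) \<longlonglongrightarrow> (\<integral>\<^sup>+y. U y * indicator {0<..<a} y \<partial>Lpos)"
  proof (rule nn_integral_dominated_convergence[where w = "\<lambda>y. U y * indicator {0<..<T} y"])
    show "(\<integral>\<^sup>+y. U y * indicator {0<..<T} y \<partial>Lpos) < \<infinity>"
      by (simp add: nn_integral_Ioo)
    show "AE y in Lpos. U y * indicator {0<..<x n} y \<le> U y * indicator {0<..<T} y" for n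
      using x(1)[rule_format, of n] by (auto simp: indicator_def)
    show "AE y in Lpos. (\<lambda>n. U y * indicator {0<..<x n} y) \<longlonglongrightarrow> U y * indicator {0<..<a} y"
      \<comment> \<open>The equivalence of the two intervals ending at a fails only at y = a, so
        this says y \<noteq> a almost everywhere; for such y the indicators are eventually constant
        in n.\<close>
      using AE_Lpos_Ioc_Ioo[of "a - 1" a]
    proof eventually_elim
      case (elim y)
      then consider "y < a" | "y > a" by fastforce
      then have "\<forall>\<^sub>F n in sequentially. U y * indicator {0<..<x n} y = U y * indicator {0<..<a} y"
      proof cases
        case 1
        show ?thesis
          by (rule eventually_mono[OF order_tendstoD(1)[OF x(2) 1]]) (use 1 in \<open>auto simp: indicator_def\<close>)
      next
        case 2
        show ?thesis
          by (rule eventually_mono[OF order_tendstoD(2)[OF x(2) 2]]) (use 2 in \<open>auto simp: indicator_def\<close>)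
      qed
      then show ?case by (rule tendsto_eventually)
    qed
  qed auto
  then have "(\<lambda>n. ennreal (V (x n))) \<longlonglongrightarrow> ennreal (V a)"
    by (simp only: nn_integral_Ioo)
  then show "(V \<circ> x) \<longlonglongrightarrow> V a"
    by (simp add: tendsto_ennreal_iff comp_def)
qed

lemma isCont_V: "0 < t \<Longrightarrow> isCont V t"
  using continuous_on_subset[OF continuous_on_V[of "t + 1"], of "{0<..<t + 1}"]
  by (simp add: continuous_on_eq_continuous_at subset_eq)

lemma V_surj:
  assumes "0 < b" "0 < y" "y \<le> V b"
  obtains t where "0 < t" "V t = y"
proof -
  have "continuous_on {0..b} V"
    by (rule continuous_on_subset[OF continuous_on_V[of "b + 1"]]) auto
  then obtain t where "0 \<le> t" "V t = y"
    using IVT'[of V 0 y b] assms by (auto simp: V_nonpos)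
  then show ?thesis using that[of t] assms(2) V_nonpos[of 0] by (cases "t = 0") auto
qed

text \<open>Points are prescribed through levels of V. Indices grow towards 0, where V tends to 0,
  so larger indices mean points and cells further to the left.\<close>

definition geometric_grid :: "real \<Rightarrow> real \<Rightarrow> (nat \<Rightarrow> real) \<Rightarrow> bool" where
  "geometric_grid l b x \<longleftrightarrow> 1 < l \<and> x 0 = b \<and> (\<forall>k. 0 < x k \<and> V (x k) = V b / l ^ k)"

lemma geometric_grid_exists:
  assumes "1 < l" "0 < b"
  obtains x where "geometric_grid l b x"
proof -
  \<comment> \<open>The clause for k = 0 is there because V may be constant on intervals: the level
    V(b) does not determine the point, and the grid must start at b itself.\<close>
  have "\<exists>t. 0 < t \<and> V t = V b / l ^ k \<and> (k = 0 \<longrightarrow> t = b)" for k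
  proof (cases "k = 0")
    case False
    have "V b / l ^ k \<le> V b"
      using assms V_pos[of b] by (simp add: divide_le_eq one_le_power)
    moreover have "0 < V b / l ^ k" using assms V_pos[of b] by simp
    ultimately show ?thesis using V_surj[of b "V b / l ^ k"] assms False by metis
  qed (use assms in auto)
  then obtain x where "\<forall>k. 0 < x k \<and> V (x k) = V b / l ^ k \<and> (k = 0 \<longrightarrow> x k = b)" by metis
  then show ?thesis using that[of x] assms by (simp add: geometric_grid_def)
qed

context
  fixes l b :: real and x :: "nat \<Rightarrow> real"
  assumes grid: "geometric_grid l b x"
begin

abbreviation "cell k \<equiv> {x (Suc k)<..x k}"

lemma grid_l: "1 < l" and grid_0: "x 0 = b" and grid_pos: "0 < x k"
  and grid_V: "V (x k) = V b / l ^ k"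
  using grid by (auto simp: geometric_grid_def)

lemma grid_V_pos: "0 < V (x k)"
  using V_pos grid_pos by blast

lemma grid_V_Suc: "V (x k) = l * V (x (Suc k))"
  using grid_l by (simp add: grid_V)

lemma grid_less: "x (Suc k) < x k"
proof -
  have "1 * V (x (Suc k)) < V (x k)"
    unfolding grid_V_Suc[of k] using grid_l grid_V_pos by (intro mult_strict_right_mono) auto
  then show ?thesis using V_mono[of "x k" "x (Suc k)"] by linarith
qed

lemma grid_antimono: "j \<le> k \<Longrightarrow> x k \<le> x j"
  by (rule lift_Suc_antimono_le[of x]) (auto simp: grid_less less_imp_le)

lemma cell_index:
  assumes "y \<in> cell j" shows "y \<in> cell k \<longleftrightarrow> k = j"
proof (cases j k rule: linorder_cases)
  case less
  then show ?thesis using grid_antimono[of "Suc j" k] assms by auto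
next
  case greater
  then show ?thesis using grid_antimono[of "Suc k" j] assms by auto
qed (use assms in auto)

lemma disjoint_cells: "disjoint_family (\<lambda>k. cell k)"
  unfolding disjoint_family_on_def using cell_index by blast

text \<open>For fixed y the levels V(b)/l^n fall below the positive number V(y), so some grid point
  lies left of y. The least index with this property is a successor, and its predecessor labels the
  cell containing y.\<close>

lemma UN_cells: "(\<Union>k. cell k) = {0<..b}"
proof (intro equalityI subsetI)
  fix y assume y: "y \<in> {0<..b}"
  then have "0 < V y" by (simp add: V_pos)
  obtain n where n: "V b / V y < l ^ n" using real_arch_pow[OF grid_l] by blast
  have "x n < y"
  proof (rule ccontr)
    assume "\<not> x n < y"
    then have "V y \<le> V b / l ^ n" using V_mono[of y "x n"] by (simp add: grid_V)
    then show False using n \<open>0 < V y\<close> grid_l by (simp add: field_simps)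
  qed
  define k where "k = (LEAST k. x k < y)"
  have "x k < y" unfolding k_def by (rule LeastI[of _ n]) (fact \<open>x n < y\<close>)
  moreover have "k \<noteq> 0" using \<open>x k < y\<close> y grid_0 by (cases k) auto
  then obtain j where j: "k = Suc j" using not0_implies_Suc by blast
  moreover have "\<not> x j < y" using not_less_Least[of j "\<lambda>k. x k < y"] j by (auto simp: k_def)
  ultimately show "y \<in> (\<Union>k. cell k)" by auto
next
  fix y assume "y \<in> (\<Union>k. cell k)"
  then obtain k where "x (Suc k) < y" "y \<le> x k" by auto
  then show "y \<in> {0<..b}" using grid_pos[of "Suc k"] grid_antimono[of 0 k] by (auto simp: grid_0)
qed

lemma suminf_cells: "(\<Sum>k. c * indicator (cell k) y) = c * (indicator {0<..b} y :: ennreal)"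
  by (simp add: suminf_indicator[OF disjoint_cells] UN_cells)

lemma nn_integral_cells:
  assumes [measurable]: "f \<in> borel_measurable M" "(\<lambda>x. x) \<in> borel_measurable M"
  shows "(\<integral>\<^sup>+y. f y * indicator {0<..b} y \<partial>M) = (\<Sum>k. \<integral>\<^sup>+y. f y * indicator (cell k) y \<partial>M)"
  unfolding suminf_cells[symmetric] by (rule nn_integral_suminf) measurable

end

end

section \<open>Upper bounds\<close>

context copson_weight
begin

definition tail :: "real \<Rightarrow> (real \<Rightarrow> ennreal) \<Rightarrow> real \<Rightarrow> ennreal" where
  "tail P F x = (\<integral>\<^sup>+y. epowr (F y) P * indicator {x<..} y \<partial>Lpos)"

text \<open>With F = (f v1)^p2 this is the q1-th power of the Copson norm of f, since F^P = (f
  v1)^p1 and Q/P = q1/p1.\<close>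

definition copson :: "real \<Rightarrow> real \<Rightarrow> (real \<Rightarrow> ennreal) \<Rightarrow> ennreal" where
  "copson P Q F = (\<integral>\<^sup>+x. U x * epowr (tail P F x) (Q / P) \<partial>Lpos)"

lemma tail_antimono: "x \<le> y \<Longrightarrow> tail P F y \<le> tail P F x"
  unfolding tail_def by (intro nn_integral_mono) (auto simp: indicator_def)

text \<open>\<open>tail\<close> is non-increasing, so \<open>copson\<close> is at least V(x) times a
  power of its value at x, and V(x) > 0. This supplies the finiteness required by Hoelder's
  inequality on the cells.\<close>

lemma tail_finite:
  assumes "0 < P" "0 < Q" "copson P Q F < top" "0 < x"
  shows "tail P F x < top"
proof -
  have "ennreal (V x) * epowr (tail P F x) (Q / P)
      = (\<integral>\<^sup>+y. U y * indicator {0<..<x} y * epowr (tail P F x) (Q / P) \<partial>Lpos)"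
    by (subst nn_integral_multc) (auto simp: nn_integral_Ioo)
  also have "\<dots> \<le> copson P Q F"
    unfolding copson_def using assms
    by (intro nn_integral_mono) (auto simp: indicator_def intro!: mult_left_mono epowr_mono tail_antimono)
  also have "\<dots> < top" by fact
  finally show ?thesis
    using V_pos[OF assms(4)] by (auto simp: ennreal_mult_less_top)
qed

context
  fixes l b :: real and x :: "nat \<Rightarrow> real"
  assumes grid: "geometric_grid l b x"
begin

text \<open>The U-mass of (x_(k+2), x_(k+1)] is V(x_k) (l-1)/l^2, and on that interval
  \<open>tail\<close> is at least its value at x_(k+1). The shift by one cell makes the comparison
  go in the right direction and produces the constant, which is 4 for l = 2.\<close>

lemma sum_tail_le_copson:
  assumes "0 < P" "0 < Q"
  shows "(\<Sum>k. ennreal (V (x k)) * epowr (tail P F (x (Suc k))) (Q / P)) \<le>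
    ennreal (l ^ 2 / (l - 1)) * copson P Q F"
proof -
  have l: "1 < l" by (rule grid_l[OF grid])
  define c where "c k = epowr (tail P F (x (Suc k))) (Q / P)" for k
  let ?I = "\<lambda>k. indicator {x (Suc (Suc k))<..x (Suc k)} :: real \<Rightarrow> ennreal"
  have V: "ennreal (V (x k)) = ennreal (l ^ 2 / (l - 1)) * (\<integral>\<^sup>+y. U y * ?I k y \<partial>Lpos)" for k
  proof -
    have "(\<integral>\<^sup>+y. U y * ?I k y \<partial>Lpos) = ennreal (V (x (Suc k)) - V (x (Suc (Suc k))))"
      using grid_less[OF grid, of "Suc k"] grid_pos[OF grid, of "Suc (Suc k)"]
      by (intro nn_integral_Ioc) auto
    moreover have "l ^ 2 / (l - 1) * (V (x (Suc k)) - V (x (Suc (Suc k)))) = V (x k)"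
      unfolding grid_V_Suc[OF grid, of k] grid_V_Suc[OF grid, of "Suc k"]
      using l by (simp add: field_simps power2_eq_square)
    ultimately show ?thesis
      using l V_mono[of "x (Suc (Suc k))" "x (Suc k)"] grid_less[OF grid, of "Suc k"]
      by (simp flip: ennreal_mult)
  qed
  have "(\<integral>\<^sup>+y. U y * ?I k y * c k \<partial>Lpos) = (\<integral>\<^sup>+y. U y * ?I k y \<partial>Lpos) * c k" for k
    by (rule nn_integral_multc) measurable
  then have "(\<Sum>k. ennreal (V (x k)) * c k)
      = ennreal (l ^ 2 / (l - 1)) * (\<Sum>k. \<integral>\<^sup>+y. U y * ?I k y * c k \<partial>Lpos)"
    by (simp only: V mult.assoc[of "ennreal _"] ennreal_suminf_cmult)
  also have "(\<Sum>k. \<integral>\<^sup>+y. U y * ?I k y * c k \<partial>Lpos) = (\<integral>\<^sup>+y. (\<Sum>k. U y * ?I k y * c k) \<partial>Lpos)"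
    by (rule nn_integral_suminf[symmetric]) measurable
  also have "\<dots> \<le> copson P Q F"
    unfolding copson_def
  proof (rule nn_integral_mono)
    fix y
    have "(\<Sum>k. U y * ?I k y * c k) \<le> (\<Sum>k. U y * epowr (tail P F y) (Q / P) * ?I k y)"
      using assms by (intro suminf_le)
        (auto simp: indicator_def c_def intro!: mult_left_mono epowr_mono tail_antimono)
    also have "\<dots> = U y * epowr (tail P F y) (Q / P) * (\<Sum>k. ?I k y)" by simp
    also have "(\<Sum>k. ?I k y) = indicator (\<Union>k. {x (Suc (Suc k))<..x (Suc k)}) y"
    proof (rule suminf_indicator)
      show "disjoint_family (\<lambda>k. {x (Suc (Suc k))<..x (Suc k)})"
        using disjoint_cells[OF grid] unfolding disjoint_family_on_def by (metis UNIV_I nat.inject)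
    qed
    also have "U y * epowr (tail P F y) (Q / P) * \<dots> \<le> U y * epowr (tail P F y) (Q / P)"
      by (auto simp: indicator_def)
    finally show "(\<Sum>k. U y * ?I k y * c k) \<le> U y * epowr (tail P F y) (Q / P)" .
  qed
  finally show ?thesis by (simp add: c_def mult_left_mono)
qed

text \<open>Hoelder on each cell is followed by two enlargements: the dual norm passes from the cell
  to (0, x_k), and the L^P mass from the cell to (x_(k+1), oo).\<close>

lemma nn_integral_le_sum_dual_norm:
  assumes "0 < P" "0 < Q" "copson P Q F < top"
    and [measurable]: "F \<in> borel_measurable Lpos" "W \<in> borel_measurable Lpos"
  shows "(\<integral>\<^sup>+y. F y * W y * indicator {0<..b} y \<partial>Lpos) \<le>
    (\<Sum>k. dual_norm Lpos P W {0<..<x k} * epowr (tail P F (x (Suc k))) (1 / P))"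
  unfolding nn_integral_cells[OF grid, of "\<lambda>y. F y * W y" Lpos, simplified]
proof (intro suminf_le)
  fix k
  let ?A = "{x (Suc k)<..x k}"
  have le: "(\<integral>\<^sup>+y. epowr (F y) P * indicator ?A y \<partial>Lpos) \<le> tail P F (x (Suc k))"
    unfolding tail_def by (intro nn_integral_mono) (auto simp: indicator_def)
  have "(\<integral>\<^sup>+y. F y * W y * indicator ?A y \<partial>Lpos) \<le>
      epowr (\<integral>\<^sup>+y. epowr (F y) P * indicator ?A y \<partial>Lpos) (1 / P) * dual_norm Lpos P W ?A"
    using le tail_finite[OF assms(1-3) grid_pos[OF grid, of "Suc k"]] assms(1)
    by (intro dual_norm_Hoelder) (auto intro: le_less_trans)
  also have "\<dots> \<le> epowr (tail P F (x (Suc k))) (1 / P) * dual_norm Lpos P W {0<..x k}"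
    using le assms(1) grid_pos[OF grid, of "Suc k"]
    by (intro mult_mono epowr_mono dual_norm_mono) auto
  also have "dual_norm Lpos P W {0<..x k} = dual_norm Lpos P W {0<..<x k}"
    by (rule dual_norm_cong_AE[OF AE_Lpos_Ioc_Ioo])
  finally show "(\<integral>\<^sup>+y. F y * W y * indicator ?A y \<partial>Lpos) \<le>
      dual_norm Lpos P W {0<..<x k} * epowr (tail P F (x (Suc k))) (1 / P)"
    by (simp add: mult.commute)
qed auto

end

text \<open>As Q \<le> 1, the Q-th power may be moved inside the series. The hypothesis on
  \<open>E\<close> turns the k-th term into E^Q V(x_k) times a power of \<open>tail\<close>, and for
  the ratio 2 these sum to at most 4 E^Q \<open>copson\<close>.\<close>

lemma copson_upper_le_1:
  assumes P: "0 < P" and Q: "0 < Q" "Q \<le> 1" and fin: "copson P Q F < top"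
    and [measurable]: "F \<in> borel_measurable Lpos" "W \<in> borel_measurable Lpos"
    and E: "\<And>t. 0 < t \<Longrightarrow> dual_norm Lpos P W {0<..<t} \<le> E * epowr (ennreal (V t)) (1 / Q)"
  shows "(\<integral>\<^sup>+x. F x * W x \<partial>Lpos) \<le> ennreal (4 powr (1 / Q)) * E * epowr (copson P Q F) (1 / Q)"
proof (rule nn_integral_le_if_bounded_parts)
  fix b :: real assume "0 < b"
  then obtain x where x: "geometric_grid 2 b x" using geometric_grid_exists[of 2 b] by auto
  define \<phi> where "\<phi> k = tail P F (x (Suc k))" for k
  have "epowr (\<integral>\<^sup>+y. F y * W y * indicator {0<..b} y \<partial>Lpos) Q \<le>
      epowr (\<Sum>k. dual_norm Lpos P W {0<..<x k} * epowr (\<phi> k) (1 / P)) Q"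
    using nn_integral_le_sum_dual_norm[OF x P Q(1) fin] Q by (intro epowr_mono) (auto simp: \<phi>_def)
  also have "\<dots> \<le> (\<Sum>k. epowr (dual_norm Lpos P W {0<..<x k} * epowr (\<phi> k) (1 / P)) Q)"
    by (rule epowr_suminf_le[OF Q])
  also have "\<dots> \<le> (\<Sum>k. epowr E Q * (ennreal (V (x k)) * epowr (\<phi> k) (Q / P)))"
  proof (intro suminf_le)
    fix k
    have "epowr (dual_norm Lpos P W {0<..<x k} * epowr (\<phi> k) (1 / P)) Q
        \<le> epowr (E * epowr (ennreal (V (x k))) (1 / Q) * epowr (\<phi> k) (1 / P)) Q"
      using grid_pos[OF x] Q by (intro epowr_mono mult_right_mono E) auto
    also have "\<dots> = epowr E Q * (ennreal (V (x k)) * epowr (\<phi> k) (Q / P))"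
      using Q by (simp add: epowr_mult epowr_epowr mult.assoc)
    finally show "epowr (dual_norm Lpos P W {0<..<x k} * epowr (\<phi> k) (1 / P)) Q \<le> \<dots>" .
  qed auto
  also have "\<dots> = epowr E Q * (\<Sum>k. ennreal (V (x k)) * epowr (\<phi> k) (Q / P))"
    by simp
  also have "\<dots> \<le> epowr E Q * (ennreal 4 * copson P Q F)"
    using sum_tail_le_copson[OF x P Q(1), of F]
    by (intro mult_left_mono) (simp_all add: \<phi>_def)
  finally have "(\<integral>\<^sup>+y. F y * W y * indicator {0<..b} y \<partial>Lpos)
      \<le> epowr (epowr E Q * (ennreal 4 * copson P Q F)) (1 / Q)"
    unfolding epowr_le_swap[OF Q(1)] .
  also have "\<dots> = ennreal (4 powr (1 / Q)) * E * epowr (copson P Q F) (1 / Q)"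
    using Q epowr_ennreal[of 4 "1 / Q"] by (simp add: epowr_mult epowr_epowr mult.commute mult.left_commute)
  finally show "(\<integral>\<^sup>+y. F y * W y * indicator {0<..b} y \<partial>Lpos) \<le> \<dots>" .
qed (auto simp: space_restrict_space)

section \<open>The Stieltjes measure of minus a negative power of the primitive\<close>

definition neg_pow :: "real \<Rightarrow> real \<Rightarrow> real" where
  "neg_pow s t = - (V t powr - s)"

lemma emeasure_neg_pow:
  assumes "0 \<le> s" "0 < c" "c \<le> d"
  shows "emeasure (stieltjes (neg_pow s)) {c<..d} = ennreal (V c powr - s - V d powr - s)"
proof -
  have "emeasure (stieltjes (neg_pow s)) {c<..d} = ennreal (neg_pow s d - neg_pow s c)"
  proof (rule emeasure_stieltjes_Ioc)
    show "mono_on {0<..} (neg_pow s)"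
      using assms(1) by (auto simp: mono_on_def neg_pow_def V_pos V_mono intro!: powr_mono2')
    fix t :: real assume "0 < t"
    then have "isCont (neg_pow s) t"
      unfolding neg_pow_def[abs_def] using isCont_V[of t] V_pos[of t]
      by (intro continuous_intros) auto
    then show "continuous (at_right t) (neg_pow s)"
      by (rule continuous_at_imp_continuous_at_within)
  qed (use assms in auto)
  then show ?thesis by (simp add: neg_pow_def)
qed

lemma space_stieltjes: "space (stieltjes h) = {0<..}"
  by (simp add: stieltjes_def space_restrict_space)

lemma sets_stieltjes [measurable_cong]: "sets (stieltjes h) = sets (restrict_space borel {0<..})"
  by (simp add: stieltjes_def)

lemma in_sets_stieltjes: "S \<in> sets borel \<Longrightarrow> S \<subseteq> {0<..} \<Longrightarrow> S \<in> sets (stieltjes h)"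
  unfolding sets_stieltjes by (subst sets_restrict_space_iff) auto

lemma measurable_ident_stieltjes [measurable]: "(\<lambda>x. x) \<in> borel_measurable (stieltjes h)"
  unfolding measurable_cong_sets[OF sets_stieltjes refl] by (rule measurable_restrict_space1) simp

lemma epowr_V_neg: "0 < t \<Longrightarrow> epowr (inverse (ennreal (V t))) s = ennreal (V t powr - s)"
  using V_pos[of t] by (simp add: inverse_ennreal epowr_ennreal powr_minus inverse_powr)

text \<open>The mass of (b,oo) is V(b)^(-s) - V(oo)^(-s), where V(oo) is the integral of U, possibly
  infinite. The second summand on the right is the defect at infinity.\<close>

lemma emeasure_neg_pow_tail:
  assumes s: "0 < s" and b: "0 < b"
  shows "ennreal (V b powr - s) \<le>
    emeasure (stieltjes (neg_pow s)) {b<..} + epowr (inverse (\<integral>\<^sup>+x. U x \<partial>Lpos)) s"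
proof -
  define c where "c = ennreal (V b powr - s)"
  define m where "m = emeasure (stieltjes (neg_pow s)) {b<..}"
  \<comment> \<open>The bound on c - m is inverted into an upper bound for V, so that the passage to
    infinity becomes monotone convergence for the integral of U; a second inversion returns to the
    claim.\<close>
  have "ennreal (V n) \<le> inverse (epowr (c - m) (1 / s))" if n: "0 < n" for n
  proof -
    define d where "d = max b n"
    have d: "0 < d" "b \<le> d" "n \<le> d" using b by (auto simp: d_def)
    have "c \<le> emeasure (stieltjes (neg_pow s)) {b<..d} + ennreal (V d powr - s)"
    proof -
      have "V d powr - s \<le> V b powr - s"
        using d s V_pos[OF b] V_mono[OF d(2)] by (intro powr_mono2') auto
      then show ?thesis
        using d b s by (simp add: emeasure_neg_pow[of s b d] c_def flip: ennreal_plus)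
    qed
    also have "\<dots> \<le> m + epowr (inverse (ennreal (V d))) s"
      unfolding m_def epowr_V_neg[OF d(1)] using b
      by (intro add_mono emeasure_mono in_sets_stieltjes) auto
    finally have "c - m \<le> epowr (inverse (ennreal (V d))) s"
      by (simp add: ennreal_minus_le_iff c_def)
    then have "epowr (c - m) (1 / s) \<le> inverse (ennreal (V d))"
      by (simp add: le_epowr_swap[OF s])
    then have "inverse (inverse (ennreal (V d))) \<le> inverse (epowr (c - m) (1 / s))"
      by (rule ennreal_inverse_antimono)
    with V_mono[OF d(3)] show ?thesis
      by (auto intro: order_trans[OF ennreal_leI])
  qed
  then have "\<And>b. 0 < b \<Longrightarrow> (\<integral>\<^sup>+x. U x * indicator {0<..b} x \<partial>Lpos) \<le> inverse (epowr (c - m) (1 / s))"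
    by (simp only: nn_integral_Ioc_0)
  then have "(\<integral>\<^sup>+x. U x \<partial>Lpos) \<le> inverse (epowr (c - m) (1 / s))"
    by (rule nn_integral_le_if_bounded_parts[rotated 3]) (auto simp: space_restrict_space)
  then have "inverse (inverse (epowr (c - m) (1 / s))) \<le> inverse (\<integral>\<^sup>+x. U x \<partial>Lpos)"
    by (rule ennreal_inverse_antimono)
  then have "c - m \<le> epowr (inverse (\<integral>\<^sup>+x. U x \<partial>Lpos)) s"
    by (simp add: le_epowr_swap[OF s])
  then show ?thesis
    by (simp add: ennreal_minus_le_iff c_def m_def)
qed

text \<open>Hoelder for series with the exponents R = Q s and Q, after inserting V(x_k)^(-1/Q)
  V(x_k)^(1/Q) = 1. One factor is again controlled by \<open>copson\<close>; the other is the sum of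
  D_k = \<omega>(x_k)^R V(x_k)^(-s), a discrete form of the Stieltjes integral.\<close>

lemma copson_upper_gt_1:
  assumes P: "0 < P" and Q: "1 < Q" and s: "s = 1 / (Q - 1)" and fin: "copson P Q F < top"
    and [measurable]: "F \<in> borel_measurable Lpos" "W \<in> borel_measurable Lpos"
    and E1: "(\<integral>\<^sup>+t. epowr (dual_norm Lpos P W {0<..<t}) (Q * s) \<partial>stieltjes (neg_pow s)) \<le> epowr E (Q * s)"
    and E2: "epowr (inverse (\<integral>\<^sup>+x. U x \<partial>Lpos)) (1 / Q) * dual_norm Lpos P W {0<..} \<le> E"
  defines "K \<equiv> (1 / (1 - 2 powr - s) + 2) powr (1 / (Q * s)) * 4 powr (1 / Q)"
  shows "(\<integral>\<^sup>+x. F x * W x \<partial>Lpos) \<le> ennreal K * E * epowr (copson P Q F) (1 / Q)"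
proof (rule nn_integral_le_if_bounded_parts)
  fix b :: real assume b: "0 < b"
  then obtain x where x: "geometric_grid 2 b x" using geometric_grid_exists[of 2 b] by auto
  define R where "R = Q * s"
  have s0: "0 < s" and R: "1 < R" "1 / R + 1 / Q = 1" "R / Q = s" "0 < R"
    using Q by (auto simp: s R_def field_simps)
  define \<omega> where "\<omega> t = dual_norm Lpos P W {0<..<t}" for t
  have \<omega>_mono: "\<omega> t \<le> \<omega> t'" if "t \<le> t'" for t t'
    unfolding \<omega>_def by (rule dual_norm_mono) (use that in auto)
  define \<phi> where "\<phi> k = tail P F (x (Suc k))" for k
  define D where "D k = epowr (\<omega> (x k)) R * ennreal (V (x k) powr - s)" for k
  let ?\<mu> = "stieltjes (neg_pow s)"
  \<comment> \<open>The cell (x_(k+1), x_k] has Stieltjes mass \<theta> V(x_(k+1))^(-s), and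
    \<omega> is at least \<omega>(x_(k+1)) on it. So D_(k+1) is charged to the cell on the right of
    x_(k+1).\<close>
  define \<theta> where "\<theta> = 1 - 2 powr - s"
  have \<theta>: "0 < \<theta>" unfolding \<theta>_def using s0 by (simp add: powr_less_one)
  have E1': "(\<integral>\<^sup>+t. epowr (\<omega> t) R \<partial>?\<mu>) \<le> epowr E R"
    using E1 by (simp add: \<omega>_def R_def)

  have cell: "{x (Suc k)<..x k} \<in> sets ?\<mu>" for k
    using grid_pos[OF x, of "Suc k"] by (intro in_sets_stieltjes) auto
  have mass: "emeasure ?\<mu> {x (Suc k)<..x k} = ennreal \<theta> * ennreal (V (x (Suc k)) powr - s)" for k
  proof -
    have "emeasure ?\<mu> {x (Suc k)<..x k} = ennreal (V (x (Suc k)) powr - s - V (x k) powr - s)"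
      using grid_pos[OF x] grid_less[OF x, of k] s0 by (intro emeasure_neg_pow) auto
    also have "V (x k) powr - s = 2 powr - s * V (x (Suc k)) powr - s"
      unfolding grid_V_Suc[OF x, of k] by (simp add: powr_mult)
    finally show ?thesis using \<theta> by (simp add: \<theta>_def algebra_simps flip: ennreal_mult)
  qed
  have "ennreal \<theta> * (\<Sum>k. D (Suc k)) = (\<Sum>k. epowr (\<omega> (x (Suc k))) R * emeasure ?\<mu> {x (Suc k)<..x k})"
    unfolding mass by (subst ennreal_suminf_cmult[symmetric]) (simp add: D_def ac_simps)
  also have "\<dots> = (\<Sum>k. \<integral>\<^sup>+t. epowr (\<omega> (x (Suc k))) R * indicator {x (Suc k)<..x k} t \<partial>?\<mu>)"
    by (simp add: nn_integral_cmult_indicator cell)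
  also have "\<dots> = (\<integral>\<^sup>+t. (\<Sum>k. epowr (\<omega> (x (Suc k))) R * indicator {x (Suc k)<..x k} t) \<partial>?\<mu>)"
    by (rule nn_integral_suminf[symmetric]) measurable
  also have "\<dots> \<le> (\<integral>\<^sup>+t. epowr (\<omega> t) R \<partial>?\<mu>)"
  proof (rule nn_integral_mono)
    fix t
    have "(\<Sum>k. epowr (\<omega> (x (Suc k))) R * indicator {x (Suc k)<..x k} t)
        \<le> (\<Sum>k. epowr (\<omega> t) R * indicator {x (Suc k)<..x k} t)"
      using R by (intro suminf_le) (auto simp: indicator_def intro!: epowr_mono \<omega>_mono)
    also have "\<dots> \<le> epowr (\<omega> t) R"
      unfolding suminf_cells[OF x] by (auto simp: indicator_def)
    finally show "(\<Sum>k. epowr (\<omega> (x (Suc k))) R * indicator {x (Suc k)<..x k} t) \<le> epowr (\<omega> t) R" .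
  qed
  also note E1'
  finally have "ennreal (1 / \<theta>) * (ennreal \<theta> * (\<Sum>k. D (Suc k))) \<le> ennreal (1 / \<theta>) * epowr E R"
    by (rule mult_left_mono) simp
  then have D_Suc: "(\<Sum>k. D (Suc k)) \<le> ennreal (1 / \<theta>) * epowr E R"
    using \<theta> by (simp flip: mult.assoc ennreal_mult)

  \<comment> \<open>No cell lies to the right of x_0 = b, so D_0 is charged to (b,oo) and to the
    boundary term. Each of them contributes at most E^R, whence the summand 2 in
    \<open>K\<close>.\<close>
  have "D 0 = epowr (\<omega> b) R * ennreal (V b powr - s)"
    by (simp add: D_def grid_0[OF x])
  also have "\<dots> \<le> epowr (\<omega> b) R * (emeasure ?\<mu> {b<..} + epowr (inverse (\<integral>\<^sup>+x. U x \<partial>Lpos)) s)"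
    by (intro mult_left_mono emeasure_neg_pow_tail s0 b) simp
  also have "\<dots> = (\<integral>\<^sup>+t. epowr (\<omega> b) R * indicator {b<..} t \<partial>?\<mu>)
      + epowr (epowr (inverse (\<integral>\<^sup>+x. U x \<partial>Lpos)) (1 / Q) * \<omega> b) R"
    using b by (simp add: distrib_left nn_integral_cmult_indicator in_sets_stieltjes
        epowr_mult epowr_epowr R mult.commute)
  also have "\<dots> \<le> (\<integral>\<^sup>+t. epowr (\<omega> t) R \<partial>?\<mu>) + epowr E R"
  proof (intro add_mono nn_integral_mono epowr_mono)
    have "\<omega> b \<le> dual_norm Lpos P W {0<..}"
      unfolding \<omega>_def by (rule dual_norm_mono) auto
    then show "epowr (inverse (\<integral>\<^sup>+x. U x \<partial>Lpos)) (1 / Q) * \<omega> b \<le> E"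
      by (intro order_trans[OF _ E2] mult_left_mono) auto
  qed (use R in \<open>auto simp: indicator_def intro!: epowr_mono \<omega>_mono\<close>)
  also have "\<dots> \<le> ennreal 2 * epowr E R"
    using E1' by (simp add: mult_2)
  finally have D_0: "D 0 \<le> ennreal 2 * epowr E R" .

  have "(\<Sum>k. D k) \<le> D 0 + (\<Sum>k. D (Suc k))"
  proof (rule suminf_le_const)
    fix n
    have "sum D {..<n} \<le> sum D {..<Suc n}" by simp
    also have "\<dots> \<le> D 0 + (\<Sum>k. D (Suc k))"
      unfolding sum.lessThan_Suc_shift by (intro add_left_mono sum_le_suminf) auto
    finally show "sum D {..<n} \<le> D 0 + (\<Sum>k. D (Suc k))" .
  qed simp
  also have "\<dots> \<le> ennreal 2 * epowr E R + ennreal (1 / \<theta>) * epowr E R"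
    by (intro add_mono D_0 D_Suc)
  also have "\<dots> = ennreal (1 / \<theta> + 2) * epowr E R"
    using \<theta> by (subst ennreal_plus) (auto simp: distrib_right add.commute)
  finally have sum_D: "(\<Sum>k. D k) \<le> ennreal (1 / \<theta> + 2) * epowr E R" .

  have "(\<integral>\<^sup>+y. F y * W y * indicator {0<..b} y \<partial>Lpos) \<le> (\<Sum>k. \<omega> (x k) * epowr (\<phi> k) (1 / P))"
    unfolding \<omega>_def \<phi>_def using Q by (intro nn_integral_le_sum_dual_norm[OF x P _ fin]) auto
  also have "\<dots> = (\<Sum>k. (\<omega> (x k) * epowr (inverse (ennreal (V (x k)))) (1 / Q)) *
      (epowr (ennreal (V (x k))) (1 / Q) * epowr (\<phi> k) (1 / P)))"
  proof (rule suminf_cong)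
    fix k
    show "\<omega> (x k) * epowr (\<phi> k) (1 / P) = (\<omega> (x k) * epowr (inverse (ennreal (V (x k)))) (1 / Q)) *
      (epowr (ennreal (V (x k))) (1 / Q) * epowr (\<phi> k) (1 / P))"
      using ennreal_mult_inverse_cancel[of "epowr (ennreal (V (x k))) (1 / Q)" "\<omega> (x k) * epowr (\<phi> k) (1 / P)"]
        grid_V_pos[OF x, of k]
      by (simp add: epowr_inverse ac_simps zero_less_iff_neq_zero)
  qed
  also have "\<dots> \<le> epowr (\<Sum>k. epowr (\<omega> (x k) * epowr (inverse (ennreal (V (x k)))) (1 / Q)) R) (1 / R) *
      epowr (\<Sum>k. epowr (epowr (ennreal (V (x k))) (1 / Q) * epowr (\<phi> k) (1 / P)) Q) (1 / Q)"
    by (rule suminf_Hoelder[OF R(1) Q R(2)])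
  also have "(\<Sum>k. epowr (\<omega> (x k) * epowr (inverse (ennreal (V (x k)))) (1 / Q)) R) = (\<Sum>k. D k)"
    by (simp add: D_def epowr_mult epowr_epowr R epowr_V_neg[OF grid_pos[OF x], symmetric])
  also have "(\<Sum>k. epowr (epowr (ennreal (V (x k))) (1 / Q) * epowr (\<phi> k) (1 / P)) Q)
      = (\<Sum>k. ennreal (V (x k)) * epowr (\<phi> k) (Q / P))"
    using Q by (simp add: epowr_mult epowr_epowr)
  also have "epowr (\<Sum>k. D k) (1 / R) * epowr (\<Sum>k. ennreal (V (x k)) * epowr (\<phi> k) (Q / P)) (1 / Q)
      \<le> epowr (ennreal (1 / \<theta> + 2) * epowr E R) (1 / R) * epowr (ennreal 4 * copson P Q F) (1 / Q)"
    using sum_tail_le_copson[OF x P, of Q F] Q R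
    by (intro mult_mono epowr_mono sum_D) (auto simp: \<phi>_def)
  also have "\<dots> = ennreal K * E * epowr (copson P Q F) (1 / Q)"
    using R \<theta> epowr_ennreal[of 4 "1 / Q"] epowr_ennreal[of "1 / \<theta> + 2" "1 / R"]
    by (simp add: epowr_mult epowr_epowr K_def \<theta>_def[symmetric] R_def[symmetric] ennreal_mult ac_simps)
  finally show "(\<integral>\<^sup>+y. F y * W y * indicator {0<..b} y \<partial>Lpos) \<le> \<dots>" .
qed (auto simp: space_restrict_space)

end

section \<open>Lower bounds\<close>

lemma ennreal_absorb:
  assumes "a \<le> ennreal (1 / 2) * a + b" "a < top" shows "a \<le> 2 * (b::ennreal)"
proof (cases b)
  case (real y)
  obtain x where x: "a = ennreal x" "0 \<le> x" using assms(2) by (cases a) auto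
  have "ennreal (1 / 2) * a + b = ennreal (1 / 2 * x) + ennreal y"
    unfolding real(2) x(1) using x(2) by (subst ennreal_mult) auto
  also have "\<dots> = ennreal (1 / 2 * x + y)"
    using real(1) x(2) by (subst ennreal_plus) auto
  finally have "ennreal x \<le> ennreal (1 / 2 * x + y)" using assms(1) x(1) by simp
  then have "x \<le> 1 / 2 * x + y" using real(1) x(2) by (subst (asm) ennreal_le_iff) auto
  then have "x \<le> 2 * y" by simp
  then show ?thesis
    using real x by (simp add: numeral_mult_ennreal ennreal_leI)
qed (simp add: ennreal_mult_top)

text \<open>Summing the recursion reproduces half of the sum of \<open>z\<close>, which can be
  subtracted because finitely many finite terms are involved. This is a discrete Hardy inequality
  for geometrically decreasing weights.\<close>

lemma sum_le_absorb_forward: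
  fixes z y :: "nat \<Rightarrow> ennreal"
  assumes "\<And>k. z k < top" "z 0 \<le> y 0" "\<And>k. z (Suc k) \<le> ennreal (1 / 2) * z k + y (Suc k)"
  shows "sum z {..<n} \<le> 2 * sum y {..<n}"
proof (cases n)
  case (Suc m)
  have "sum z {..<n} \<le> y 0 + (\<Sum>k<m. ennreal (1 / 2) * z k + y (Suc k))"
    unfolding Suc sum.lessThan_Suc_shift by (intro add_mono sum_mono assms)
  also have "\<dots> = ennreal (1 / 2) * sum z {..<m} + sum y {..<n}"
    unfolding Suc sum.lessThan_Suc_shift by (simp add: sum.distrib sum_distrib_left ac_simps)
  also have "\<dots> \<le> ennreal (1 / 2) * sum z {..<n} + sum y {..<n}"
    unfolding Suc by (intro add_right_mono mult_left_mono) auto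
  finally show ?thesis
    by (rule ennreal_absorb) (simp add: assms(1))
qed simp

text \<open>The recursion refers to the next index, so a finite sum is not closed under it: the end
  term z_n survives and has to be bounded by other means.\<close>

lemma sum_le_absorb_backward:
  fixes z y :: "nat \<Rightarrow> ennreal"
  assumes "\<And>k. z k < top" "\<And>k. z k \<le> ennreal (1 / 2) * z (Suc k) + y k"
  shows "sum z {..<n} \<le> 2 * (z n + sum y {..<n})"
proof (rule ennreal_absorb)
  have "sum z {..<n} \<le> (\<Sum>k<n. ennreal (1 / 2) * z (Suc k) + y k)"
    by (intro sum_mono assms)
  also have "\<dots> = ennreal (1 / 2) * (\<Sum>k<n. z (Suc k)) + sum y {..<n}"
    by (simp add: sum.distrib sum_distrib_left)
  also have "(\<Sum>k<n. z (Suc k)) \<le> sum z {..<Suc n}"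
    unfolding sum.lessThan_Suc_shift by simp
  also have "\<dots> = sum z {..<n} + z n" by simp
  also have "ennreal (1 / 2) * (sum z {..<n} + z n) + sum y {..<n}
      \<le> ennreal (1 / 2) * sum z {..<n} + (z n + sum y {..<n})"
  proof -
    have "ennreal (1 / 2) \<le> ennreal 1" by (rule ennreal_leI) simp
    then have "ennreal (1 / 2) * z n \<le> 1 * z n" by (intro mult_right_mono) (simp_all only: ennreal_1 zero_le)
    then show ?thesis by (auto simp: distrib_left add.assoc intro!: add_mono)
  qed
  finally show "sum z {..<n} \<le> ennreal (1 / 2) * sum z {..<n} + (z n + sum y {..<n})"
    by (simp add: add_mono mult_left_mono)
qed (simp add: assms(1))

text \<open>The supremum need not be attained, but a finite positive one is exceeded after halving;
  for the value 0 the zero function serves.\<close>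

lemma dual_norm_attained_half:
  assumes "dual_norm M p w A < top"
  obtains f where "f \<in> borel_measurable M" "(\<integral>\<^sup>+x. epowr (f x) p * indicator A x \<partial>M) \<le> 1"
    "dual_norm M p w A \<le> 2 * (\<integral>\<^sup>+x. f x * w x * indicator A x \<partial>M)"
proof (cases "dual_norm M p w A = 0")
  case True
  then show ?thesis using that[of "\<lambda>_. 0"] by auto
next
  case False
  then obtain r where r: "dual_norm M p w A = ennreal r" "0 < r"
    using assms by (cases "dual_norm M p w A") (auto simp: less_le)
  then have "ennreal (r / 2) < dual_norm M p w A" by (simp add: ennreal_lessI)
  then obtain f where f: "f \<in> borel_measurable M" "(\<integral>\<^sup>+x. epowr (f x) p * indicator A x \<partial>M) \<le> 1"
    "ennreal (r / 2) < (\<integral>\<^sup>+x. f x * w x * indicator A x \<partial>M)"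
    unfolding dual_norm_def less_SUP_iff by auto
  have "dual_norm M p w A = 2 * ennreal (r / 2)"
    using r by (simp add: numeral_mult_ennreal)
  also have "\<dots> \<le> 2 * (\<integral>\<^sup>+x. f x * w x * indicator A x \<partial>M)"
    using f(3) by (intro mult_left_mono) auto
  finally show ?thesis using that f by blast
qed

context copson_weight
begin

text \<open>Test with F cut off to B. As B is an initial interval, \<open>tail\<close> is at most 1
  on B and vanishes at points outside it, so \<open>copson\<close> is at most the U-mass of B. Both
  (0,t) and the whole half-line are of this kind.\<close>

lemma copson_lower_simple:
  assumes PQ: "0 < P" "0 < Q" and B: "B \<in> sets borel" "\<And>x y. x \<in> B \<Longrightarrow> 0 < y \<Longrightarrow> y < x \<Longrightarrow> y \<in> B"
    and fin: "(\<integral>\<^sup>+x. U x * indicator B x \<partial>Lpos) < top"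
    and [measurable]: "W \<in> borel_measurable Lpos"
    and test: "\<And>F. F \<in> borel_measurable Lpos \<Longrightarrow> copson P Q F < top \<Longrightarrow>
      (\<integral>\<^sup>+x. F x * W x \<partial>Lpos) \<le> C * epowr (copson P Q F) (1 / Q)"
  shows "dual_norm Lpos P W B \<le> C * epowr (\<integral>\<^sup>+x. U x * indicator B x \<partial>Lpos) (1 / Q)"
  unfolding dual_norm_def
proof (rule SUP_least, clarify)
  have [measurable]: "Measurable.pred Lpos (\<lambda>x. x \<in> B)"
    using B(1) by measurable
  fix F :: "real \<Rightarrow> ennreal"
  assume [measurable]: "F \<in> borel_measurable Lpos"
    and F: "(\<integral>\<^sup>+x. epowr (F x) P * indicator B x \<partial>Lpos) \<le> 1"
  let ?F = "\<lambda>x. F x * indicator B x"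
  have tail: "U x * epowr (tail P ?F x) (Q / P) \<le> U x * indicator B x" if "0 < x" for x
  proof (cases "x \<in> B")
    case True
    have "tail P ?F x \<le> (\<integral>\<^sup>+x. epowr (F x) P * indicator B x \<partial>Lpos)"
      unfolding tail_def by (intro nn_integral_mono) (auto simp: indicator_def)
    with F have "epowr (tail P ?F x) (Q / P) \<le> epowr 1 (Q / P)"
      using PQ by (intro epowr_mono) auto
    then have "U x * epowr (tail P ?F x) (Q / P) \<le> U x * 1" by (intro mult_left_mono) auto
    with True show ?thesis by simp
  next
    case False
    have "tail P ?F x = (\<integral>\<^sup>+x. 0 \<partial>Lpos)"
      unfolding tail_def using False B(2)[OF _ that]
      by (intro nn_integral_cong) (auto simp: indicator_def)
    then show ?thesis by simp
  qed
  then have le: "copson P Q ?F \<le> (\<integral>\<^sup>+x. U x * indicator B x \<partial>Lpos)"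
    unfolding copson_def by (intro nn_integral_mono) (auto simp: space_restrict_space)
  have "(\<integral>\<^sup>+x. F x * W x * indicator B x \<partial>Lpos) = (\<integral>\<^sup>+x. ?F x * W x \<partial>Lpos)"
    by (simp add: ac_simps)
  also have "\<dots> \<le> C * epowr (copson P Q ?F) (1 / Q)"
    using le fin by (intro test) (auto intro: le_less_trans)
  also have "\<dots> \<le> C * epowr (\<integral>\<^sup>+x. U x * indicator B x \<partial>Lpos) (1 / Q)"
    using le PQ by (intro mult_left_mono epowr_mono) auto
  finally show "(\<integral>\<^sup>+x. F x * W x * indicator B x \<partial>Lpos) \<le> \<dots>" .
qed

lemma copson_lower_Ioo:
  assumes PQ: "0 < P" "0 < Q" and W: "W \<in> borel_measurable Lpos" and t: "0 < t"
    and test: "\<And>F. F \<in> borel_measurable Lpos \<Longrightarrow> copson P Q F < top \<Longrightarrow>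
      (\<integral>\<^sup>+x. F x * W x \<partial>Lpos) \<le> C * epowr (copson P Q F) (1 / Q)"
  shows "dual_norm Lpos P W {0<..<t} \<le> C * epowr (ennreal (V t)) (1 / Q)"
  unfolding nn_integral_Ioo[symmetric]
proof (rule copson_lower_simple[OF PQ _ _ _ W])
  show "(\<integral>\<^sup>+x. U x * indicator {0<..<t} x \<partial>Lpos) < top" by (simp add: nn_integral_Ioo)
qed (use test in auto)

text \<open>If the integral of U is infinite, the factor in front is 0. Otherwise the whole
  half-line is an admissible initial interval of finite positive mass.\<close>

lemma copson_lower_boundary:
  assumes PQ: "0 < P" "0 < Q" and W: "W \<in> borel_measurable Lpos"
    and test: "\<And>F. F \<in> borel_measurable Lpos \<Longrightarrow> copson P Q F < top \<Longrightarrow>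
      (\<integral>\<^sup>+x. F x * W x \<partial>Lpos) \<le> C * epowr (copson P Q F) (1 / Q)"
  shows "epowr (inverse (\<integral>\<^sup>+x. U x \<partial>Lpos)) (1 / Q) * dual_norm Lpos P W {0<..} \<le> C"
proof (cases "(\<integral>\<^sup>+x. U x \<partial>Lpos) < top")
  case True
  let ?I = "\<integral>\<^sup>+x. U x \<partial>Lpos"
  have I: "(\<integral>\<^sup>+x. U x * indicator {0<..} x \<partial>Lpos) = ?I"
    by (intro nn_integral_cong) (auto simp: space_restrict_space)
  have "ennreal (V 1) \<le> ?I"
    unfolding nn_integral_Ioo[symmetric] by (intro nn_integral_mono) (auto simp: indicator_def)
  then have pos: "0 < ?I" using V_pos[of 1] by (auto simp: zero_less_iff_neq_zero)
  have "dual_norm Lpos P W {0<..} \<le> C * epowr ?I (1 / Q)"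
    unfolding I[symmetric]
  proof (rule copson_lower_simple[OF PQ _ _ _ W])
    show "(\<integral>\<^sup>+x. U x * indicator {0<..} x \<partial>Lpos) < top" using True by (simp add: I)
  qed (use test in auto)
  then have "epowr (inverse ?I) (1 / Q) * dual_norm Lpos P W {0<..}
      \<le> epowr (inverse ?I) (1 / Q) * (C * epowr ?I (1 / Q))"
    by (rule mult_left_mono) simp
  also have "\<dots> = epowr ?I (1 / Q) * (inverse (epowr ?I (1 / Q)) * C)"
    by (simp add: epowr_inverse ac_simps)
  also have "\<dots> = C"
    using pos True by (intro ennreal_mult_inverse_cancel) (auto simp: zero_less_iff_neq_zero)
  finally show ?thesis .
qed (simp add: less_top[symmetric])

text \<open>To the right of a point of cell j only pieces with index k \<le> j contribute, so
  \<open>tail\<close> is at most the sum of the a_k^P, and P \<ge> 1 bounds this by the P-th power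
  of the sum of the a_k. Passing from the l^P to the l^1 norm leaves a Hardy sum that does not
  involve P.\<close>

lemma copson_step_le:
  assumes PQ: "1 \<le> P" "0 < Q" and x: "geometric_grid l b x"
    and f: "\<And>k. f k \<in> borel_measurable Lpos"
      "\<And>k. (\<integral>\<^sup>+y. epowr (f k y) P * indicator {x (Suc k)<..x k} y \<partial>Lpos) \<le> 1"
  shows "copson P Q (\<lambda>y. \<Sum>k<n. a k * f k y * indicator {x (Suc k)<..x k} y) \<le>
    (\<Sum>k. ennreal (V (x k)) * epowr (\<Sum>j\<in>{..k} \<inter> {..<n}. a j) Q)"
proof -
  let ?I = "\<lambda>k. indicator {x (Suc k)<..x k} :: real \<Rightarrow> ennreal"
  \<comment> \<open>The test function has n pieces, yet every cell to the left of them still sees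
    its tail. The outer series therefore runs over all k, with a partial sum that stops growing at
    n.\<close>
  let ?J = "\<lambda>k. {..k} \<inter> {..<n}"
  define F where "F y = (\<Sum>k<n. a k * f k y * ?I k y)" for y
  define B where "B k = (\<Sum>j\<in>?J k. a j)" for k
  note f(1)[measurable]
  have F: "F y = (if k < n then a k * f k y else 0)" if "y \<in> {x (Suc k)<..x k}" for k y
  proof -
    have "F y = (\<Sum>j<n. if k = j then a j * f j y else 0)"
      unfolding F_def using cell_index[OF x that] by (intro sum.cong) (auto simp: indicator_def)
    then show ?thesis by simp
  qed
  have F0: "F y = 0" if "y > b" for y
  proof -
    have "y \<notin> {x (Suc k)<..x k}" for k
      using that grid_antimono[OF x, of 0 k] grid_0[OF x] by auto
    then show ?thesis by (simp add: F_def)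
  qed
  have tail: "tail P F y \<le> epowr (B j) P" if y: "y \<in> {x (Suc j)<..x j}" for j y
  proof -
    have "tail P F y \<le> (\<integral>\<^sup>+z. (\<Sum>k\<in>?J j. epowr (a k) P * (epowr (f k z) P * ?I k z)) \<partial>Lpos)"
      unfolding tail_def
    proof (rule nn_integral_mono)
      fix z assume "z \<in> space Lpos"
      then have "0 < z" by (simp add: space_restrict_space)
      consider "z > b" | "z \<le> y" | "z \<le> b" "z > y" by linarith
      then show "epowr (F z) P * indicator {y<..} z \<le>
          (\<Sum>k\<in>?J j. epowr (a k) P * (epowr (f k z) P * ?I k z))"
      proof cases
        case 3
        then have "z \<in> (\<Union>k. {x (Suc k)<..x k})" using UN_cells[OF x] \<open>0 < z\<close> by auto
        then obtain k where k: "z \<in> {x (Suc k)<..x k}" by blast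
        have "k \<le> j"
        proof (rule ccontr)
          assume "\<not> k \<le> j"
          then show False using grid_antimono[OF x, of "Suc j" k] k y 3 by auto
        qed
        show ?thesis
        proof (cases "k < n")
          case True
          have "epowr (F z) P * indicator {y<..} z = epowr (a k) P * (epowr (f k z) P * ?I k z)"
            using F[OF k] True k 3 by (simp add: epowr_mult)
          also have "\<dots> \<le> (\<Sum>k\<in>?J j. epowr (a k) P * (epowr (f k z) P * ?I k z))"
            using \<open>k \<le> j\<close> True by (intro member_le_sum) auto
          finally show ?thesis .
        qed (simp add: F[OF k])
      qed (auto simp: F0)
    qed
    also have "\<dots> = (\<Sum>k\<in>?J j. epowr (a k) P * (\<integral>\<^sup>+z. epowr (f k z) P * ?I k z \<partial>Lpos))"
      by (simp add: nn_integral_sum nn_integral_cmult)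
    also have "\<dots> \<le> (\<Sum>k\<in>?J j. epowr (a k) P * 1)"
      by (intro sum_mono mult_left_mono f) auto
    also have "\<dots> \<le> epowr (B j) P"
      unfolding B_def using sum_epowr_le[OF PQ(1), of "?J j" a] by simp
    finally show ?thesis .
  qed
  have "copson P Q F \<le> (\<integral>\<^sup>+y. (\<Sum>k. U y * ?I k y * epowr (B k) Q) \<partial>Lpos)"
    unfolding copson_def
  proof (rule nn_integral_mono)
    fix y assume "y \<in> space Lpos"
    then have "0 < y" by (simp add: space_restrict_space)
    show "U y * epowr (tail P F y) (Q / P) \<le> (\<Sum>k. U y * ?I k y * epowr (B k) Q)"
    proof (cases "y \<le> b")
      case True
      then have "y \<in> (\<Union>k. {x (Suc k)<..x k})" using UN_cells[OF x] \<open>0 < y\<close> by auto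
      then obtain k where k: "y \<in> {x (Suc k)<..x k}" by blast
      have "epowr (tail P F y) (Q / P) \<le> epowr (epowr (B k) P) (Q / P)"
        using PQ by (intro epowr_mono tail k) auto
      also have "\<dots> = epowr (B k) Q" using PQ by (simp add: epowr_epowr)
      finally have "U y * epowr (tail P F y) (Q / P) \<le> U y * ?I k y * epowr (B k) Q"
        using k by (auto intro: mult_left_mono)
      also have "\<dots> \<le> (\<Sum>k. U y * ?I k y * epowr (B k) Q)"
        using sum_le_suminf[of "\<lambda>k. U y * ?I k y * epowr (B k) Q" "{k}"] by simp
      finally show ?thesis .
    next
      case False
      then have "tail P F y = (\<integral>\<^sup>+z. 0 \<partial>Lpos)"
        unfolding tail_def by (intro nn_integral_cong) (auto simp: indicator_def F0)
      then show ?thesis by simp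
    qed
  qed
  also have "\<dots> = (\<Sum>k. \<integral>\<^sup>+y. U y * ?I k y * epowr (B k) Q \<partial>Lpos)"
    by (rule nn_integral_suminf) measurable
  also have "\<dots> \<le> (\<Sum>k. ennreal (V (x k)) * epowr (B k) Q)"
  proof (intro suminf_le)
    fix k
    have "(\<integral>\<^sup>+y. U y * ?I k y * epowr (B k) Q \<partial>Lpos) = (\<integral>\<^sup>+y. U y * ?I k y \<partial>Lpos) * epowr (B k) Q"
      by (rule nn_integral_multc) measurable
    also have "(\<integral>\<^sup>+y. U y * ?I k y \<partial>Lpos) \<le> ennreal (V (x k))"
      unfolding nn_integral_Ioc_0[symmetric] using grid_pos[OF x, of "Suc k"]
      by (intro nn_integral_mono) (auto simp: indicator_def)
    finally show "(\<integral>\<^sup>+y. U y * ?I k y * epowr (B k) Q \<partial>Lpos) \<le> ennreal (V (x k)) * epowr (B k) Q"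
      by (simp add: mult_right_mono)
  qed auto
  finally show ?thesis by (simp add: F_def[abs_def] B_def)
qed

text \<open>The equality case of Hoelder for sequences: a_k = (\<sigma>_k / V(x_k))^s makes a_k
  \<sigma>_k, V(x_k) a_k^Q and V(x_k)^(-s) \<sigma>_k^(Q s) the same number, whose sum over k < n is
  T. Testing yields T \<le> const C T^(1/Q), and dividing by T^(1/Q) leaves T^(1/(Q s)) on the
  left.\<close>

lemma copson_lower_cells:
  assumes P: "1 \<le> P" and Q: "1 < Q" and s: "s = 1 / (Q - 1)" and C: "C < top"
    and x: "geometric_grid (4 powr Q) b x"
    and W [measurable]: "W \<in> borel_measurable Lpos"
    and test: "\<And>F. F \<in> borel_measurable Lpos \<Longrightarrow> copson P Q F < top \<Longrightarrow>
      (\<integral>\<^sup>+x. F x * W x \<partial>Lpos) \<le> C * epowr (copson P Q F) (1 / Q)"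
    and fin: "\<And>k. dual_norm Lpos P W {x (Suc k)<..x k} < top"
  shows "(\<Sum>k<n. ennreal (V (x k) powr - s) * epowr (dual_norm Lpos P W {x (Suc k)<..x k}) (Q * s)) \<le>
    ennreal ((2 * (2 * 2 powr Q) powr (1 / Q)) powr (Q * s)) * epowr C (Q * s)"
proof -
  let ?I = "\<lambda>k. indicator {x (Suc k)<..x k} :: real \<Rightarrow> ennreal"
  let ?J = "\<lambda>k. {..k} \<inter> {..<n}"
  define \<sigma> where "\<sigma> k = dual_norm Lpos P W {x (Suc k)<..x k}" for k
  define a where "a k = epowr (\<sigma> k * inverse (ennreal (V (x k)))) s" for k
  define T where "T = (\<Sum>k<n. a k * \<sigma> k)"
  have s0: "0 < s" and R: "Q * s = s + 1" "1 < Q * s" "s * Q = s + 1" "1 / (Q * s) + 1 / Q = 1"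
    using Q by (auto simp: s field_simps)
  have Vk: "0 < V (x k)" for k by (rule grid_V_pos[OF x])
  have \<sigma>_fin: "\<sigma> k < top" for k unfolding \<sigma>_def by (rule fin)
  have a_fin: "a k < top" for k
    using \<sigma>_fin[of k] Vk[of k] by (auto simp: a_def inverse_ennreal ennreal_mult_less_top)
  have a_\<sigma>: "a k * \<sigma> k = ennreal (V (x k) powr - s) * epowr (\<sigma> k) (Q * s)" for k
    unfolding R(1) a_def by (simp add: epowr_mult epowr_V_neg[OF grid_pos[OF x]] epowr_add ac_simps)
  have V_a: "ennreal (V (x k)) * epowr (a k) Q = a k * \<sigma> k" for k
    using Vk[of k] ennreal_mult_inverse_cancel[of "ennreal (V (x k))" "a k * \<sigma> k"]
    by (simp add: a_def epowr_epowr R epowr_add ac_simps)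

  have "\<exists>f. f \<in> borel_measurable Lpos \<and> (\<integral>\<^sup>+y. epowr (f y) P * ?I k y \<partial>Lpos) \<le> 1 \<and>
      \<sigma> k \<le> 2 * (\<integral>\<^sup>+y. f y * W y * ?I k y \<partial>Lpos)" for k
    by (rule dual_norm_attained_half[OF fin[of k], folded \<sigma>_def]) blast
  then have "\<forall>k. \<exists>f. f \<in> borel_measurable Lpos \<and> (\<integral>\<^sup>+y. epowr (f y) P * ?I k y \<partial>Lpos) \<le> 1 \<and>
      \<sigma> k \<le> 2 * (\<integral>\<^sup>+y. f y * W y * ?I k y \<partial>Lpos)" ..
  from choice[OF this] obtain f where all: "\<forall>k. f k \<in> borel_measurable Lpos \<and>
      (\<integral>\<^sup>+y. epowr (f k y) P * ?I k y \<partial>Lpos) \<le> 1 \<and>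
      \<sigma> k \<le> 2 * (\<integral>\<^sup>+y. f k y * W y * ?I k y \<partial>Lpos)" ..
  have f [measurable]: "f k \<in> borel_measurable Lpos"
    and f1: "(\<integral>\<^sup>+y. epowr (f k y) P * ?I k y \<partial>Lpos) \<le> 1"
    and f2: "\<sigma> k \<le> 2 * (\<integral>\<^sup>+y. f k y * W y * ?I k y \<partial>Lpos)" for k
    using spec[OF all, of k] by auto
  define F where "F y = (\<Sum>k<n. a k * f k y * ?I k y)" for y
  have F_meas [measurable]: "F \<in> borel_measurable Lpos"
    unfolding F_def[abs_def] by measurable

  have "T \<le> (\<Sum>k<n. a k * (2 * (\<integral>\<^sup>+y. f k y * W y * ?I k y \<partial>Lpos)))"
    unfolding T_def by (intro sum_mono mult_left_mono f2) simp
  also have "\<dots> = 2 * (\<Sum>k<n. a k * (\<integral>\<^sup>+y. f k y * W y * ?I k y \<partial>Lpos))"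
    by (simp add: sum_distrib_left ac_simps)
  also have "(\<Sum>k<n. a k * (\<integral>\<^sup>+y. f k y * W y * ?I k y \<partial>Lpos))
      = (\<integral>\<^sup>+y. (\<Sum>k<n. a k * (f k y * W y * ?I k y)) \<partial>Lpos)"
    by (simp add: nn_integral_sum nn_integral_cmult)
  also have "\<dots> = (\<integral>\<^sup>+y. F y * W y \<partial>Lpos)"
    unfolding F_def sum_distrib_right by (simp add: ac_simps)
  finally have T_le: "T \<le> 2 * (\<integral>\<^sup>+y. F y * W y \<partial>Lpos)" .

  define z where "z k = ennreal (V (x k)) * epowr (\<Sum>j\<in>?J k. a j) Q" for k
  define y where "y k = ennreal (2 powr Q) * (if k < n then a k * \<sigma> k else 0)" for k
  have J: "?J (Suc k) = (if Suc k < n then insert (Suc k) (?J k) else ?J k)" for k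
    by auto
  have sum_z: "sum z {..<N} \<le> 2 * sum y {..<N}" for N
  proof (rule sum_le_absorb_forward)
    show "z k < top" for k
      using a_fin by (auto simp: z_def ennreal_mult_less_top)
    have "1 \<le> ennreal (2 powr Q)"
      using Q by (metis ennreal_1 ennreal_leI ge_one_powr_ge_zero less_imp_le one_le_numeral order_trans zero_le_one)
    then have "1 * (a 0 * \<sigma> 0) \<le> ennreal (2 powr Q) * (a 0 * \<sigma> 0)" by (rule mult_right_mono) simp
    then show "z 0 \<le> y 0"
      by (cases "0 < n") (auto simp: z_def y_def V_a)
    fix k
    define A where "A = (\<Sum>j\<in>?J k. a j)"
    define a' where "a' = (if Suc k < n then a (Suc k) else 0)"
    have "(\<Sum>j\<in>?J (Suc k). a j) = A + a'"
      unfolding J A_def a'_def by (simp add: add.commute)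
    then have "z (Suc k) \<le> ennreal (V (x (Suc k))) * (ennreal (2 powr Q) * (epowr A Q + epowr a' Q))"
      unfolding z_def using Q by (auto intro!: mult_left_mono epowr_add_le)
    also have "\<dots> = ennreal (2 powr Q) * ennreal (V (x (Suc k))) * epowr A Q
        + ennreal (2 powr Q) * (ennreal (V (x (Suc k))) * epowr a' Q)"
      by (simp add: algebra_simps)
    also have "ennreal (V (x (Suc k))) * epowr a' Q = (if Suc k < n then a (Suc k) * \<sigma> (Suc k) else 0)"
      by (simp add: a'_def V_a)
    \<comment> \<open>The ratio 4^Q enters here: the factor 2^Q of the quasi-triangle inequality
      times 4^(-Q) is 2^(-Q), which is at most 1/2 because Q > 1.\<close>
    also have "ennreal (2 powr Q) * ennreal (V (x (Suc k))) \<le> ennreal (1 / 2) * ennreal (V (x k))"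
    proof -
      have "4 powr Q = 2 powr Q * (2::real) powr Q" by (simp flip: powr_mult)
      moreover have "2 powr 1 \<le> (2::real) powr Q" using Q by (intro powr_mono) auto
      ultimately have "2 powr Q * V (x (Suc k)) \<le> 1 / 2 * V (x k)"
        unfolding grid_V_Suc[OF x, of k] using Vk[of "Suc k"] by (simp add: mult_left_mono)
      then show ?thesis
        by (subst (1 2) ennreal_mult[symmetric]) (auto intro: ennreal_leI)
    qed
    finally show "z (Suc k) \<le> ennreal (1 / 2) * z k + y (Suc k)"
      by (simp add: z_def y_def A_def mult_right_mono mult.assoc)
  qed
  have sum_y: "sum y {..<N} \<le> ennreal (2 powr Q) * T" for N
  proof -
    have "sum y {..<N} \<le> sum y {..<max N n}" by (intro sum_mono2) auto
    also have "\<dots> = sum y {..<n}" by (intro sum.mono_neutral_right) (auto simp: y_def)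
    also have "\<dots> = ennreal (2 powr Q) * T" by (simp add: y_def T_def sum_distrib_left)
    finally show ?thesis .
  qed
  have "copson P Q F \<le> (\<Sum>k. z k)"
    using copson_step_le[OF P _ x f f1, where Q = Q and n = n and a = a] Q by (simp add: F_def[abs_def] z_def)
  also have "\<dots> \<le> 2 * (ennreal (2 powr Q) * T)"
  proof (rule suminf_le_const)
    fix N
    show "sum z {..<N} \<le> 2 * (ennreal (2 powr Q) * T)"
      by (rule order_trans[OF sum_z mult_left_mono[OF sum_y]]) simp
  qed simp
  also have "\<dots> = ennreal (2 * 2 powr Q) * T"
    by (simp add: ennreal_mult mult.assoc)
  finally have copson_le: "copson P Q F \<le> ennreal (2 * 2 powr Q) * T" .

  \<comment> \<open>Finiteness of T makes \<open>copson\<close> of the test function finite, so that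
    the hypothesis applies to it, and permits the division by T^(1/Q) below.\<close>
  have T_fin: "T < top"
    using a_fin \<sigma>_fin by (auto simp: T_def ennreal_mult_less_top)
  then have "copson P Q F < top"
    using copson_le by (auto simp: ennreal_mult_less_top intro: le_less_trans)
  then have "T \<le> 2 * (C * epowr (copson P Q F) (1 / Q))"
    by (intro order_trans[OF T_le] mult_left_mono test F_meas) auto
  also have "\<dots> \<le> 2 * (C * epowr (ennreal (2 * 2 powr Q) * T) (1 / Q))"
    using Q by (intro mult_left_mono epowr_mono copson_le) auto
  also have "\<dots> = 2 * (C * (ennreal ((2 * 2 powr Q) powr (1 / Q)) * epowr T (1 / Q)))"
    unfolding epowr_mult by (subst epowr_ennreal) auto
  also have "\<dots> = ennreal (2 * (2 * 2 powr Q) powr (1 / Q)) * C * epowr T (1 / Q)"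
    by (simp add: numeral_mult_ennreal[symmetric] ac_simps)
  \<comment> \<open>The outer 2 stems from half-attained suprema, the inner one from absorption, and
    2^Q from the quasi-triangle inequality.\<close>
  finally have le: "T \<le> ennreal (2 * (2 * 2 powr Q) powr (1 / Q)) * C * epowr T (1 / Q)" .
  have "epowr T (1 / (Q * s)) \<le> ennreal (2 * (2 * 2 powr Q) powr (1 / Q)) * C"
  proof (cases "T = 0")
    case False
    let ?t = "epowr T (1 / Q)"
    have t: "0 < ?t" "?t < top" using False T_fin by (auto simp: zero_less_iff_neq_zero)
    have "epowr T (1 / (Q * s)) = ?t * (inverse ?t * epowr T (1 / (Q * s)))"
      using t by (simp add: ennreal_mult_inverse_cancel)
    also have "\<dots> = inverse ?t * epowr T (1 / (Q * s) + 1 / Q)"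
      by (simp only: epowr_add ac_simps)
    also have "\<dots> = inverse ?t * T" unfolding R(4) by simp
    also have "\<dots> \<le> inverse ?t * (ennreal (2 * (2 * 2 powr Q) powr (1 / Q)) * C * ?t)"
      by (intro mult_left_mono le) simp
    also have "\<dots> = ?t * (inverse ?t * (ennreal (2 * (2 * 2 powr Q) powr (1 / Q)) * C))"
      by (simp only: ac_simps)
    also have "\<dots> = ennreal (2 * (2 * 2 powr Q) powr (1 / Q)) * C"
      using t by (rule ennreal_mult_inverse_cancel)
    finally show ?thesis .
  qed simp
  then have "T \<le> epowr (ennreal (2 * (2 * 2 powr Q) powr (1 / Q)) * C) (Q * s)"
    unfolding le_epowr_swap[OF order.strict_trans[OF zero_less_one R(2)]] .
  also have "\<dots> = ennreal ((2 * (2 * 2 powr Q) powr (1 / Q)) powr (Q * s)) * epowr C (Q * s)"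
    unfolding epowr_mult by (simp only: epowr_ennreal powr_ge_zero mult_nonneg_nonneg zero_le_numeral)
  finally show ?thesis unfolding T_def a_\<sigma> unfolding \<sigma>_def .
qed

text \<open>Superlevel sets of a monotone function are intervals. \<open>dual_norm\<close> on (0,t)
  is a supremum over an uncountable family, so its measurability in t is derived from
  monotonicity.\<close>

lemma borel_measurable_mono_ennreal:
  fixes f :: "real \<Rightarrow> ennreal"
  assumes "mono f" shows "f \<in> borel_measurable borel"
proof (rule borel_measurableI_greater)
  fix y
  have "is_interval {x. y < f x}"
    unfolding is_interval_1 using assms by (auto simp: mono_def intro: less_le_trans)
  then show "{x \<in> space borel. y < f x} \<in> sets borel"
    by (simp add: real_interval_borel_measurable)
qed

text \<open>Splitting (0, x_k] into (0, x_(k+1)] and a cell gives \<omega>(x_k) \<le>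
  \<omega>(x_(k+1)) + \<sigma>_k. This recursion is absorbed backwards: the cell terms are covered
  by \<open>copson_lower_cells\<close>, the surviving end term D_n by the single-interval
  bound.\<close>

lemma copson_lower_gt_1:
  assumes P: "1 \<le> P" and Q: "1 < Q" and s: "s = 1 / (Q - 1)"
    and W [measurable]: "W \<in> borel_measurable Lpos"
    and test: "\<And>F. F \<in> borel_measurable Lpos \<Longrightarrow> copson P Q F < top \<Longrightarrow>
      (\<integral>\<^sup>+x. F x * W x \<partial>Lpos) \<le> C * epowr (copson P Q F) (1 / Q)"
  defines "K \<equiv> (2 * (2 * 2 powr Q) powr (1 / Q)) powr (Q * s)"
  shows "(\<integral>\<^sup>+t. epowr (dual_norm Lpos P W {0<..<t}) (Q * s) \<partial>stieltjes (neg_pow s)) \<le>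
    ennreal (4 powr (Q * s) * (2 * (1 + 2 powr (Q * s) * K))) * epowr C (Q * s)"
proof (cases "C < top")
  case False
  have "0 < 4 powr (Q * s) * (2 * (1 + 2 powr (Q * s) * K))"
    by (simp add: K_def add_pos_nonneg)
  moreover have "ennreal k * epowr C (Q * s) = top" if "0 < k" for k
    using False that by (simp add: less_top[symmetric] ennreal_mult_top)
  ultimately show ?thesis by (simp only: top_greatest)
next
  case C: True
  define R where "R = Q * s"
  have s0: "0 < s" and R: "1 < R" "R / Q = s"
    using Q by (auto simp: s R_def field_simps)
  define \<omega> where "\<omega> t = dual_norm Lpos P W {0<..<t}" for t
  have \<omega>_mono: "\<omega> t \<le> \<omega> t'" if "t \<le> t'" for t t'
    unfolding \<omega>_def by (rule dual_norm_mono) (use that in auto)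
  have \<omega>_le: "\<omega> t \<le> C * epowr (ennreal (V t)) (1 / Q)" if "0 < t" for t
    unfolding \<omega>_def by (rule copson_lower_Ioo[OF _ _ W that test]) (use P Q in auto)
  have \<omega>_fin: "\<omega> t < top" if "0 < t" for t
    using \<omega>_le[OF that] C by (auto simp: ennreal_mult_less_top intro: le_less_trans)
  let ?\<mu> = "stieltjes (neg_pow s)"
  have "(\<lambda>t. epowr (\<omega> t) R) \<in> borel_measurable borel"
    using R by (intro borel_measurable_mono_ennreal monoI epowr_mono \<omega>_mono) auto
  then have \<omega>_meas [measurable]: "(\<lambda>t. epowr (\<omega> t) R) \<in> borel_measurable ?\<mu>"
    unfolding measurable_cong_sets[OF sets_stieltjes refl] by (rule measurable_restrict_space1)
  have "(\<integral>\<^sup>+t. epowr (\<omega> t) R \<partial>?\<mu>) \<le> ennreal (4 powr R * (2 * (1 + 2 powr R * K))) * epowr C R"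
  proof (rule nn_integral_le_if_bounded_parts[OF \<omega>_meas measurable_ident_stieltjes])
    fix b :: real assume b: "0 < b"
    then obtain x where x: "geometric_grid (4 powr Q) b x"
      using geometric_grid_exists[of "4 powr Q" b] Q by auto
    let ?I = "\<lambda>k. indicator {x (Suc k)<..x k} :: real \<Rightarrow> ennreal"
    define \<sigma> where "\<sigma> k = dual_norm Lpos P W {x (Suc k)<..x k}" for k
    define w where "w k = V (x k) powr - s" for k
    define D where "D k = epowr (\<omega> (x k)) R * ennreal (w k)" for k
    have Ioc: "\<omega> t = dual_norm Lpos P W {0<..t}" for t
      unfolding \<omega>_def by (rule dual_norm_cong_AE[OF AE_Lpos_Ioc_Ioo, symmetric])
    have "\<sigma> k \<le> \<omega> (x k)" for k
      unfolding Ioc \<sigma>_def using grid_pos[OF x, of "Suc k"] by (intro dual_norm_mono) auto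
    then have \<sigma>_fin: "\<sigma> k < top" for k
      using \<omega>_fin[OF grid_pos[OF x]] by (rule le_less_trans)
    have \<omega>_step: "\<omega> (x k) \<le> \<omega> (x (Suc k)) + \<sigma> k" for k
    proof -
      have "{0<..x k} = {0<..x (Suc k)} \<union> {x (Suc k)<..x k}"
        using grid_pos[OF x, of "Suc k"] grid_less[OF x, of k] by auto
      then show ?thesis
        unfolding Ioc \<sigma>_def using P by (auto intro!: dual_norm_Un)
    qed
    \<comment> \<open>Since Q s = R, the ratio 4^Q makes the weights grow by 4^R from one grid point
      to the next, which beats the 2^R of the quasi-triangle inequality.\<close>
    have w: "w (Suc k) = 4 powr R * w k" for k
    proof -
      have "w k = (4 powr Q) powr - s * w (Suc k)"
        unfolding w_def grid_V_Suc[OF x, of k] by (simp add: powr_mult)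
      also have "(4 powr Q) powr - s = inverse ((4::real) powr R)"
        unfolding powr_powr by (simp add: R_def powr_minus)
      finally show ?thesis by simp
    qed
    have D_fin: "D k < top" for k
      using \<omega>_fin[OF grid_pos[OF x]] by (auto simp: D_def ennreal_mult_less_top)
    have D_le: "D k \<le> epowr C R" for k
    proof -
      have v: "0 < epowr (ennreal (V (x k))) s" "epowr (ennreal (V (x k))) s < top"
        using grid_V_pos[OF x, of k] by (auto simp: zero_less_iff_neq_zero)
      have "D k \<le> epowr (C * epowr (ennreal (V (x k))) (1 / Q)) R * ennreal (w k)"
        unfolding D_def using R by (intro mult_right_mono epowr_mono \<omega>_le grid_pos[OF x]) auto
      also have "\<dots> = epowr (ennreal (V (x k))) s * (inverse (epowr (ennreal (V (x k))) s) * epowr C R)"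
        using epowr_V_neg[OF grid_pos[OF x, of k], of s]
        by (simp add: w_def epowr_mult epowr_epowr R(2) epowr_inverse ac_simps)
      also have "\<dots> = epowr C R" using v by (rule ennreal_mult_inverse_cancel)
      finally show ?thesis .
    qed
    have sum_D: "sum D {..<n} \<le> ennreal (2 * (1 + 2 powr R * K)) * epowr C R" for n
    proof -
      define y where "y k = ennreal (2 powr R) * (ennreal (w k) * epowr (\<sigma> k) R)" for k
      have "sum D {..<n} \<le> 2 * (D n + sum y {..<n})"
      proof (rule sum_le_absorb_backward[OF D_fin])
        fix k
        have "D k \<le> epowr (\<omega> (x (Suc k)) + \<sigma> k) R * ennreal (w k)"
          unfolding D_def using R by (intro mult_right_mono epowr_mono \<omega>_step) auto
        also have "\<dots> \<le> ennreal (2 powr R) * (epowr (\<omega> (x (Suc k))) R + epowr (\<sigma> k) R) * ennreal (w k)"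
          using R by (intro mult_right_mono epowr_add_le) auto
        also have "\<dots> = ennreal (2 powr R) * ennreal (w k) * epowr (\<omega> (x (Suc k))) R + y k"
          by (simp add: y_def algebra_simps)
        also have "ennreal (2 powr R) * ennreal (w k) \<le> ennreal (1 / 2) * ennreal (w (Suc k))"
        proof -
          have "4 powr R = 2 powr R * (2::real) powr R" by (simp flip: powr_mult)
          moreover have "2 powr 1 \<le> (2::real) powr R" using R by (intro powr_mono) auto
          ultimately have "2 powr R * w k \<le> 1 / 2 * w (Suc k)"
            unfolding w by (simp add: w_def mult_right_mono mult.commute)
          then show ?thesis
            by (subst (1 2) ennreal_mult[symmetric]) (auto intro: ennreal_leI simp: w_def)
        qed
        finally show "D k \<le> ennreal (1 / 2) * D (Suc k) + y k"
          by (simp add: D_def mult_right_mono ac_simps)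
      qed
      also have "\<dots> \<le> 2 * (epowr C R + ennreal (2 powr R) * (ennreal K * epowr C R))"
      proof -
        have "(\<Sum>k<n. ennreal (w k) * epowr (\<sigma> k) R) \<le> ennreal K * epowr C R"
          unfolding w_def \<sigma>_def R_def K_def
          by (rule copson_lower_cells[OF P Q s C x W test]) (use \<sigma>_fin in \<open>auto simp: \<sigma>_def\<close>)
        then show ?thesis
          unfolding y_def sum_distrib_left[symmetric] by (intro mult_left_mono add_mono D_le) auto
      qed
      also have "\<dots> = ennreal (2 * (1 + 2 powr R * K)) * epowr C R"
        by (simp add: K_def ennreal_mult ennreal_plus distrib_right mult.assoc)
      finally show ?thesis .
    qed
    have cell: "{x (Suc k)<..x k} \<in> sets ?\<mu>" for k
      using grid_pos[OF x, of "Suc k"] by (intro in_sets_stieltjes) auto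
    \<comment> \<open>The mass of a cell is at most the weight at its left end point, which is 4^R
      times the weight at the right one, where \<omega> is largest. This is the source of 4^R in the
      constant.\<close>
    have mass: "emeasure ?\<mu> {x (Suc k)<..x k} \<le> ennreal (4 powr R) * ennreal (w k)" for k
    proof -
      have "emeasure ?\<mu> {x (Suc k)<..x k} = ennreal (w (Suc k) - w k)"
        unfolding w_def using grid_pos[OF x] grid_less[OF x, of k] s0 by (intro emeasure_neg_pow) auto
      also have "\<dots> \<le> ennreal (w (Suc k))" by (intro ennreal_leI) (simp add: w_def)
      finally show ?thesis unfolding w by (simp add: ennreal_mult w_def)
    qed
    have "(\<integral>\<^sup>+t. epowr (\<omega> t) R * indicator {0<..b} t \<partial>?\<mu>)
        = (\<Sum>k. \<integral>\<^sup>+t. epowr (\<omega> t) R * ?I k t \<partial>?\<mu>)"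
      by (rule nn_integral_cells[OF x \<omega>_meas measurable_ident_stieltjes])
    also have "\<dots> \<le> (\<Sum>k. ennreal (4 powr R) * D k)"
    proof (intro suminf_le)
      fix k
      have "(\<integral>\<^sup>+t. epowr (\<omega> t) R * ?I k t \<partial>?\<mu>) \<le> (\<integral>\<^sup>+t. epowr (\<omega> (x k)) R * ?I k t \<partial>?\<mu>)"
        using R by (intro nn_integral_mono) (auto simp: indicator_def intro!: epowr_mono \<omega>_mono)
      also have "\<dots> = epowr (\<omega> (x k)) R * emeasure ?\<mu> {x (Suc k)<..x k}"
        by (rule nn_integral_cmult_indicator[OF cell])
      also have "\<dots> \<le> epowr (\<omega> (x k)) R * (ennreal (4 powr R) * ennreal (w k))"
        by (intro mult_left_mono mass) simp
      finally show "(\<integral>\<^sup>+t. epowr (\<omega> t) R * ?I k t \<partial>?\<mu>) \<le> ennreal (4 powr R) * D k"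
        by (simp add: D_def ac_simps)
    qed auto
    also have "\<dots> = ennreal (4 powr R) * (\<Sum>k. D k)" by simp
    also have "\<dots> \<le> ennreal (4 powr R) * (ennreal (2 * (1 + 2 powr R * K)) * epowr C R)"
      by (intro mult_left_mono suminf_le_const sum_D) auto
    also have "\<dots> = ennreal (4 powr R * (2 * (1 + 2 powr R * K))) * epowr C R"
      by (subst ennreal_mult) (auto simp: K_def mult.assoc)
    finally show "(\<integral>\<^sup>+t. epowr (\<omega> t) R * indicator {0<..b} t \<partial>?\<mu>) \<le> \<dots>" .
  qed (simp add: space_stieltjes)
  then show ?thesis by (simp add: \<omega>_def R_def)
qed

end

section \<open>Identification of the dual norm\<close>

lemma emeasure_Lpos_Ioc: "emeasure Lpos {0<..real n} = ennreal n"
  by (subst emeasure_restrict_space) auto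

lemma sigma_finite_Lpos: "sigma_finite_measure Lpos"
proof
  show "\<exists>A. countable A \<and> A \<subseteq> sets Lpos \<and> \<Union> A = space Lpos \<and> (\<forall>a\<in>A. emeasure Lpos a \<noteq> \<infinity>)"
  proof (intro exI[of _ "range (\<lambda>n. {0<..real n})"] conjI)
    show "range (\<lambda>n. {0<..real n}) \<subseteq> sets Lpos"
      by (auto simp: sets_restrict_space_iff)
    show "\<Union> (range (\<lambda>n. {0<..real n})) = space Lpos"
      by (auto simp: space_restrict_space intro: real_arch_simple)
  qed (auto simp: emeasure_Lpos_Ioc)
qed

lemma lebesgue_on_eq_restrict:
  assumes "A \<in> sets lebesgue" "A \<subseteq> {0<..}"
  shows "lebesgue_on A = restrict_space Lpos A"
proof -
  have "{0<..} \<inter> A = A" using assms by auto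
  then show ?thesis using assms by (subst restrict_restrict_space) auto
qed

lemma nn_integral_lebesgue_on_subset:
  assumes "A \<in> sets lebesgue" "A \<subseteq> {0<..}"
  shows "(\<integral>\<^sup>+x. f x \<partial>lebesgue_on A) = (\<integral>\<^sup>+x. f x * indicator A x \<partial>Lpos)"
proof -
  have "A \<inter> space Lpos \<in> sets Lpos"
    using assms by (auto simp: space_restrict_space sets_restrict_space_iff)
  then show ?thesis
    unfolding lebesgue_on_eq_restrict[OF assms] by (rule nn_integral_restrict_space)
qed

lemma dual_norm_lebesgue_on:
  assumes "A \<in> sets lebesgue" "A \<subseteq> {0<..}"
    and "f \<in> borel_measurable Lpos" "(\<integral>\<^sup>+x. epowr (f x) p \<partial>lebesgue_on A) \<le> 1"
  shows "(\<integral>\<^sup>+x. f x * w x \<partial>lebesgue_on A) \<le> dual_norm Lpos p w A"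
  using assms(4) unfolding nn_integral_lebesgue_on_subset[OF assms(1,2)]
  by (rule dual_norm_upper[OF assms(3)])

lemma dual_norm_leI:
  assumes "A \<in> sets lebesgue" "A \<subseteq> {0<..}"
    and "\<And>f. f \<in> borel_measurable Lpos \<Longrightarrow> (\<integral>\<^sup>+x. epowr (f x) p \<partial>lebesgue_on A) \<le> 1 \<Longrightarrow>
      (\<integral>\<^sup>+x. f x * w x \<partial>lebesgue_on A) \<le> K"
  shows "dual_norm Lpos p w A \<le> K"
  unfolding dual_norm_def
  by (rule SUP_least) (use assms(3) in \<open>simp add: nn_integral_lebesgue_on_subset[OF assms(1,2)]\<close>)

lemma measurable_lebesgue_on_subset:
  assumes "A \<in> sets lebesgue" "A \<subseteq> {0<..}" "f \<in> borel_measurable Lpos"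
  shows "f \<in> borel_measurable (lebesgue_on A)"
  unfolding lebesgue_on_eq_restrict[OF assms(1,2)] by (rule measurable_restrict_space1[OF assms(3)])

text \<open>The dual of L^1. If w > z on a non-null part of A, a normalised indicator inside that
  part is a competitor whose value is at least z^p.\<close>

lemma dual_norm_one:
  assumes A: "A \<in> sets lebesgue" "A \<subseteq> {0<..}" and p: "0 < p"
    and w [measurable]: "w \<in> borel_measurable Lpos"
  shows "dual_norm Lpos 1 (\<lambda>x. epowr (w x) p) A = epowr (esssup (lebesgue_on A) w) p"
    (is "?d = epowr ?S p")
proof (rule antisym)
  note meas = measurable_lebesgue_on_subset[OF A]
  have [measurable]: "(\<lambda>x. indicator A x :: ennreal) \<in> borel_measurable Lpos"
    by (intro measurable_restrict_space1 borel_measurable_indicator A)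
  show "?d \<le> epowr ?S p"
  proof (rule dual_norm_leI[OF A])
    fix f assume f [measurable]: "f \<in> borel_measurable Lpos"
      and f1: "(\<integral>\<^sup>+x. epowr (f x) 1 \<partial>lebesgue_on A) \<le> 1"
    have "(\<integral>\<^sup>+x. f x * epowr (w x) p \<partial>lebesgue_on A) \<le> (\<integral>\<^sup>+x. f x * epowr ?S p \<partial>lebesgue_on A)"
      using esssup_AE[of w "lebesgue_on A"] p
      by (intro nn_integral_mono_AE) (auto elim!: eventually_mono intro!: mult_left_mono epowr_mono)
    also have "\<dots> = (\<integral>\<^sup>+x. f x \<partial>lebesgue_on A) * epowr ?S p"
      using meas[OF f] by (rule nn_integral_multc)
    also have "\<dots> \<le> 1 * epowr ?S p" using f1 by (intro mult_right_mono) auto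
    finally show "(\<integral>\<^sup>+x. f x * epowr (w x) p \<partial>lebesgue_on A) \<le> epowr ?S p" by simp
  qed
  show "epowr ?S p \<le> ?d"
    unfolding epowr_le_swap[OF p]
  proof (rule dense_ge)
    fix z assume "epowr ?d (1 / p) < z"
    then have dz: "?d < epowr z p"
      using le_epowr_swap[OF p, of z] by (metis epowr_le_swap linorder_not_le p)
    let ?E = "{x. z < w x}"
    show "?S \<le> z"
    proof (rule esssup_I)
      show "AE x in lebesgue_on A. w x \<le> z"
      proof (rule ccontr)
        assume notAE: "\<not> (AE x in lebesgue_on A. w x \<le> z)"
        \<comment> \<open>Cutting with (0,b] gives the superlevel set finite measure, so that its
          indicator can be normalised; exhaustion in b then makes the whole set null.\<close>
        have "(\<integral>\<^sup>+x. indicator ?E x * indicator A x * indicator {0<..b} x \<partial>Lpos) = 0" if b: "0 < b" for b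
        proof (rule ccontr)
          let ?B = "\<lambda>x. indicator ?E x * indicator {0<..b} x :: ennreal"
          assume "(\<integral>\<^sup>+x. indicator ?E x * indicator A x * indicator {0<..b} x \<partial>Lpos) \<noteq> 0"
          then have nz: "(\<integral>\<^sup>+x. ?B x \<partial>lebesgue_on A) \<noteq> 0"
            by (simp add: nn_integral_lebesgue_on_subset[OF A] ac_simps)
          define m where "m = (\<integral>\<^sup>+x. ?B x \<partial>lebesgue_on A)"
          obtain n where n: "b \<le> real n" using real_arch_simple by blast
          have "m \<le> (\<integral>\<^sup>+x. indicator {0<..real n} x \<partial>Lpos)"
            unfolding m_def nn_integral_lebesgue_on_subset[OF A]
            using n by (intro nn_integral_mono) (auto simp: indicator_def)
          also have "\<dots> < top"
            by (subst nn_integral_indicator) (auto simp: emeasure_Lpos_Ioc sets_restrict_space_iff)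
          finally have m: "0 < m" "m < top"
            using nz by (auto simp: m_def zero_less_iff_neq_zero)
          let ?f = "\<lambda>x. inverse m * ?B x"
          have [measurable]: "?B \<in> borel_measurable Lpos" by measurable
          then have fm: "?f \<in> borel_measurable Lpos" by measurable
          have "(\<integral>\<^sup>+x. ?f x \<partial>lebesgue_on A) = inverse m * m"
            unfolding m_def by (rule nn_integral_cmult) (rule meas, measurable)
          also have "\<dots> = 1"
            using ennreal_mult_inverse_cancel[OF m, of 1] by (simp add: mult.commute)
          finally have f1: "(\<integral>\<^sup>+x. ?f x \<partial>lebesgue_on A) = 1" .
          have "epowr z p = (\<integral>\<^sup>+x. ?f x \<partial>lebesgue_on A) * epowr z p" by (simp add: f1)
          also have "\<dots> = (\<integral>\<^sup>+x. ?f x * epowr z p \<partial>lebesgue_on A)"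
            by (rule nn_integral_multc[symmetric, OF meas[OF fm]])
          also have "\<dots> \<le> (\<integral>\<^sup>+x. ?f x * epowr (w x) p \<partial>lebesgue_on A)"
            using p by (intro nn_integral_mono)
              (auto simp: indicator_def intro!: mult_left_mono epowr_mono)
          also have "\<dots> \<le> ?d"
            using f1 by (intro dual_norm_lebesgue_on[OF A fm]) simp
          finally show False using dz by simp
        qed
        then have "\<And>b. 0 < b \<Longrightarrow> (\<integral>\<^sup>+x. indicator ?E x * indicator A x * indicator {0<..b} x \<partial>Lpos) \<le> 0"
          by simp
        then have "(\<integral>\<^sup>+x. indicator ?E x * indicator A x \<partial>Lpos) \<le> 0"
          by (rule nn_integral_le_if_bounded_parts[rotated 3]) (auto simp: space_restrict_space)
        then have "(\<integral>\<^sup>+x. indicator ?E x \<partial>lebesgue_on A) = 0"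
          by (simp add: nn_integral_lebesgue_on_subset[OF A])
        moreover have "(\<lambda>x. indicator ?E x :: ennreal) \<in> borel_measurable (lebesgue_on A)"
          by (rule meas) measurable
        ultimately have "AE x in lebesgue_on A. (indicator ?E x :: ennreal) = 0"
          using nn_integral_0_iff_AE by blast
        then have "AE x in lebesgue_on A. w x \<le> z"
          by (auto simp: indicator_def elim!: eventually_mono split: if_splits)
        with notAE show False by simp
      qed
    qed (rule meas[OF w])
  qed
qed

text \<open>One direction is Hoelder. For the other the extremal function is a multiple of w^(q-1),
  since (q-1) p = q; truncation makes its norm finite and monotone convergence removes the
  truncation.\<close>

lemma dual_norm_gt_1:
  assumes A: "A \<in> sets lebesgue" "A \<subseteq> {0<..}" and pq: "1 < p" "1 < q" "1 / p + 1 / q = 1"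
    and w [measurable]: "w \<in> borel_measurable Lpos" and fin: "AE x in Lpos. w x < top"
  shows "dual_norm Lpos p w A = epowr (\<integral>\<^sup>+x. epowr (w x) q \<partial>lebesgue_on A) (1 / q)"
    (is "?d = _")
proof (rule antisym)
  note meas = measurable_lebesgue_on_subset[OF A]
  have [measurable]: "(\<lambda>x. indicator A x :: ennreal) \<in> borel_measurable Lpos"
    by (intro measurable_restrict_space1 borel_measurable_indicator A)
  show "?d \<le> epowr (\<integral>\<^sup>+x. epowr (w x) q \<partial>lebesgue_on A) (1 / q)"
  proof (rule dual_norm_leI[OF A])
    fix f assume f [measurable]: "f \<in> borel_measurable Lpos"
      and f1: "(\<integral>\<^sup>+x. epowr (f x) p \<partial>lebesgue_on A) \<le> 1"
    have "(\<integral>\<^sup>+x. f x * w x \<partial>lebesgue_on A) \<le> epowr (\<integral>\<^sup>+x. epowr (f x) p \<partial>lebesgue_on A) (1 / p) *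
        epowr (\<integral>\<^sup>+x. epowr (w x) q \<partial>lebesgue_on A) (1 / q)"
      by (rule nn_integral_Hoelder[OF pq meas[OF f] meas[OF w]])
    also have "\<dots> \<le> epowr 1 (1 / p) * epowr (\<integral>\<^sup>+x. epowr (w x) q \<partial>lebesgue_on A) (1 / q)"
      using pq f1 by (intro mult_right_mono epowr_mono) auto
    finally show "(\<integral>\<^sup>+x. f x * w x \<partial>lebesgue_on A) \<le> epowr (\<integral>\<^sup>+x. epowr (w x) q \<partial>lebesgue_on A) (1 / q)"
      by simp
  qed
  have q: "(q - 1) * p = q" "1 - 1 / p = 1 / q" using pq by (auto simp: field_simps)
  \<comment> \<open>Bounding both w and x by n makes the integral over the set finite. These sets
    exhaust {w < oo}, which is where a.e. finiteness of w is used.\<close>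
  define E where "E n = {x. w x \<le> of_nat n \<and> x \<le> real n}" for n :: nat
  have E [measurable]: "Measurable.pred Lpos (\<lambda>x. x \<in> E n)" for n
    unfolding E_def by measurable
  define I where "I n = (\<integral>\<^sup>+x. epowr (w x) q * indicator (E n) x \<partial>lebesgue_on A)" for n
  have I_le: "I n \<le> epowr ?d q" for n
  proof (cases "I n = 0")
    case False
    have "I n \<le> (\<integral>\<^sup>+x. epowr (of_nat n) q * indicator {0<..real n} x \<partial>Lpos)"
      unfolding I_def nn_integral_lebesgue_on_subset[OF A] using pq A(2)
      by (intro nn_integral_mono) (auto simp: indicator_def E_def intro!: epowr_mono)
    also have "\<dots> = epowr (of_nat n) q * ennreal n"
      by (subst nn_integral_cmult_indicator) (auto simp: emeasure_Lpos_Ioc sets_restrict_space_iff)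
    also have "\<dots> < top" by (simp add: ennreal_mult_less_top ennreal_of_nat_eq_real_of_nat)
    finally have I: "0 < I n" "I n < top" using False by (auto simp: zero_less_iff_neq_zero)
    \<comment> \<open>This factor turns the truncated extremal into a unit vector of L^p; its
      pairing with w is then c I_n = I_n^(1/q).\<close>
    define c where "c = inverse (epowr (I n) (1 / p))"
    let ?f = "\<lambda>x. c * (epowr (w x) (q - 1) * indicator (E n) x)"
    have fm: "?f \<in> borel_measurable Lpos" by measurable
    have "(\<integral>\<^sup>+x. epowr (?f x) p \<partial>lebesgue_on A)
        = (\<integral>\<^sup>+x. epowr c p * (epowr (w x) q * indicator (E n) x) \<partial>lebesgue_on A)"
      by (intro nn_integral_cong) (auto simp: epowr_mult epowr_epowr q indicator_def)
    also have "\<dots> = epowr c p * I n"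
      unfolding I_def by (rule nn_integral_cmult) (rule meas, measurable)
    also have "epowr c p = inverse (I n)"
      using pq by (simp add: c_def epowr_epowr flip: epowr_inverse)
    also have "inverse (I n) * I n = 1"
      using ennreal_mult_inverse_cancel[OF I, of 1] by (simp add: mult.commute)
    finally have f1: "(\<integral>\<^sup>+x. epowr (?f x) p \<partial>lebesgue_on A) = 1" .
    have "c * I n = (\<integral>\<^sup>+x. c * (epowr (w x) q * indicator (E n) x) \<partial>lebesgue_on A)"
      unfolding I_def by (rule nn_integral_cmult[symmetric]) (rule meas, measurable)
    also have "\<dots> = (\<integral>\<^sup>+x. ?f x * w x \<partial>lebesgue_on A)"
    proof (rule nn_integral_cong)
      fix x
      have "epowr (w x) q = epowr (w x) (q - 1) * w x"
        using epowr_add[of "w x" "q - 1" 1] by simp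
      then show "c * (epowr (w x) q * indicator (E n) x) = ?f x * w x" by (simp add: ac_simps)
    qed
    also have "\<dots> \<le> ?d"
      by (rule dual_norm_lebesgue_on[OF A fm]) (simp add: f1)
    finally have "c * I n \<le> ?d" .
    moreover have "epowr (I n) (1 / q) = c * I n"
    proof -
      have "I n = epowr (I n) (1 / p) * epowr (I n) (1 / q)"
        using epowr_add[of "I n" "1 / p" "1 / q"] pq by simp
      then have "c * I n = epowr (I n) (1 / p) * (c * epowr (I n) (1 / q))"
        by (metis mult.left_commute)
      also have "\<dots> = epowr (I n) (1 / q)"
        unfolding c_def using I by (intro ennreal_mult_inverse_cancel) (auto simp: zero_less_iff_neq_zero)
      finally show ?thesis ..
    qed
    ultimately show ?thesis using pq by (subst le_epowr_swap) auto
  qed simp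
  have "AE x in Lpos. epowr (w x) q * indicator A x
      = (SUP n. epowr (w x) q * indicator (E n) x * indicator A x)"
    using fin
  proof eventually_elim
    case (elim x)
    then obtain y where y: "w x = ennreal y" "0 \<le> y" by (cases "w x") auto
    obtain n where n: "max x y \<le> real n" using real_arch_simple by blast
    have "x \<in> E n" using n y by (auto simp: E_def ennreal_of_nat_eq_real_of_nat intro: ennreal_leI)
    show ?case
    proof (rule antisym)
      show "epowr (w x) q * indicator A x \<le> (SUP n. epowr (w x) q * indicator (E n) x * indicator A x)"
        by (rule SUP_upper2[of n]) (use \<open>x \<in> E n\<close> in auto)
    qed (auto intro!: SUP_least simp: indicator_def)
  qed
  then have "(\<integral>\<^sup>+x. epowr (w x) q \<partial>lebesgue_on A)
      = (\<integral>\<^sup>+x. (SUP n. epowr (w x) q * indicator (E n) x * indicator A x) \<partial>Lpos)"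
    unfolding nn_integral_lebesgue_on_subset[OF A] by (rule nn_integral_cong_AE)
  also have "\<dots> = (SUP n. \<integral>\<^sup>+x. epowr (w x) q * indicator (E n) x * indicator A x \<partial>Lpos)"
  proof (rule nn_integral_monotone_convergence_SUP)
    have "E m \<subseteq> E n" if "m \<le> n" for m n
      using that by (auto simp: E_def intro: order_trans of_nat_mono)
    then show "incseq (\<lambda>n x. epowr (w x) q * indicator (E n) x * indicator A x)"
      by (auto simp: incseq_def le_fun_def indicator_def)
    show "(\<lambda>x. epowr (w x) q * indicator (E n) x * indicator A x) \<in> borel_measurable Lpos" for n
      by measurable
  qed
  also have "\<dots> \<le> epowr ?d q"
    using I_le by (auto intro!: SUP_least simp: I_def nn_integral_lebesgue_on_subset[OF A])
  finally show "epowr (\<integral>\<^sup>+x. epowr (w x) q \<partial>lebesgue_on A) (1 / q) \<le> ?d"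
    using pq by (subst le_epowr_swap[symmetric]) auto
qed

lemma exp_to_ennreal:
  assumes "0 < q" "q < p" shows "exp_to (ennreal p) (ennreal q) = ennreal (p * q / (p - q))"
proof -
  have "1 / ennreal q - 1 / ennreal p = ennreal (1 / q - 1 / p)"
    using assms by (simp add: divide_ennreal_def inverse_ennreal ennreal_minus inverse_eq_divide)
  moreover have "1 / q - 1 / p = (p - q) / (p * q)" using assms by (simp add: field_simps)
  ultimately show ?thesis
    using assms by (simp add: exp_to_def ennreal_less_iff divide_ennreal_def inverse_ennreal inverse_eq_divide)
qed

text \<open>The exponent conjugate to p1/p2 is p1/(p1 - p2), and p2 times it is p1 \<rightarrow> p2.
  For p1 = p2 the dual of L^1 accounts for the value oo.\<close>

lemma dual_norm_eq_Lnorm: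
  assumes A: "A \<in> sets lebesgue" "A \<subseteq> {0<..}" and p: "0 < p2" "p2 \<le> p1"
    and w [measurable]: "w \<in> borel_measurable Lpos" and fin: "AE x in Lpos. w x < top"
  shows "dual_norm Lpos (p1 / p2) (\<lambda>x. epowr (w x) p2) A
    = epowr (Lnorm (exp_to (ennreal p1) (ennreal p2)) A w) p2"
proof (cases "p1 = p2")
  case True
  then show ?thesis
    using dual_norm_one[OF A p(1) w] p by (simp add: exp_to_def Lnorm_def)
next
  case False
  define r where "r = p1 * p2 / (p1 - p2)"
  have pq: "1 < p1 / p2" "1 < p1 / (p1 - p2)" "1 / (p1 / p2) + 1 / (p1 / (p1 - p2)) = 1"
    using p False by (auto simp: field_simps)
  have r: "0 < r" "p2 * (p1 / (p1 - p2)) = r" "p2 / r = 1 / (p1 / (p1 - p2))"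
    using p False by (auto simp: r_def field_simps)
  have "dual_norm Lpos (p1 / p2) (\<lambda>x. epowr (w x) p2) A
      = epowr (\<integral>\<^sup>+x. epowr (epowr (w x) p2) (p1 / (p1 - p2)) \<partial>lebesgue_on A) (1 / (p1 / (p1 - p2)))"
    using fin by (intro dual_norm_gt_1[OF A pq]) auto
  also have "\<dots> = epowr (\<integral>\<^sup>+x. epowr (w x) r \<partial>lebesgue_on A) (p2 / r)"
    by (simp only: epowr_epowr r)
  also have "\<dots> = epowr (Lnorm (ennreal r) A w) p2"
    using r(1) by (simp add: Lnorm_def epowr_epowr)
  finally show ?thesis
    using exp_to_ennreal[of p2 p1] p False by (simp add: r_def)
qed

section \<open>Embeddings of Copson spaces into Cesaro spaces\<close>

lemma inverse_mult_le_iff: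
  assumes "0 < a" "a < top" shows "inverse a * b \<le> c \<longleftrightarrow> b \<le> c * (a::ennreal)"
proof
  assume "inverse a * b \<le> c"
  then have "a * (inverse a * b) \<le> a * c" by (rule mult_left_mono) simp
  then show "b \<le> c * a" unfolding ennreal_mult_inverse_cancel[OF assms] by (simp add: mult.commute)
next
  assume "b \<le> c * a"
  then have "inverse a * b \<le> inverse a * (c * a)" by (rule mult_left_mono) simp
  also have "\<dots> = a * (inverse a * c)" by (simp only: ac_simps)
  finally show "inverse a * b \<le> c" using assms by (simp add: ennreal_mult_inverse_cancel)
qed

lemma equiv_up_toI:
  assumes "0 < k" "0 < l" "ennreal (1 / k) * b \<le> a" "a \<le> ennreal l * b"
  shows "equiv_up_to (max k l) a b"
  unfolding equiv_up_to_def
proof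
  have "ennreal (1 / max k l) * b \<le> ennreal (1 / k) * b"
    using assms(1,2) by (intro mult_right_mono ennreal_leI) (auto simp: field_simps)
  then show "ennreal (1 / max k l) * b \<le> a" using assms(3) by simp
  have "ennreal l * b \<le> ennreal (max k l) * b"
    by (intro mult_right_mono ennreal_leI) auto
  then show "a \<le> ennreal (max k l) * b" using assms(4) by simp
qed

lemma Lnorm_real: "0 < p \<Longrightarrow> Lnorm (ennreal p) A f = epowr (\<integral>\<^sup>+x. epowr (f x) p \<partial>lebesgue_on A) (1 / p)"
  by (simp add: Lnorm_def)

locale copson_cesaro =
  fixes p1 p2 q1 :: real and v1 v2 u1 u2 :: "real \<Rightarrow> ennreal"
  assumes p2: "0 < p2" and p12: "p2 \<le> p1" and q1: "0 < q1"
    and v1: "v1 \<in> weights" and v2: "v2 \<in> weights"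
    and u1: "u1 \<in> cOmega (ennreal q1)" and u2: "u2 \<in> Omega (ennreal p2)"
begin

lemma measurable_weights [measurable]:
  "v1 \<in> borel_measurable Lpos" "v2 \<in> borel_measurable Lpos"
  "u1 \<in> borel_measurable Lpos" "u2 \<in> borel_measurable Lpos"
  using v1 v2 u1 u2 by (auto simp: weights_def cOmega_def Omega_def Mplus_def)

definition U :: "real \<Rightarrow> ennreal" where "U x = epowr (u1 x) q1"

lemma nn_integral_U:
  assumes "A \<in> sets lebesgue" "A \<subseteq> {0<..}"
  shows "(\<integral>\<^sup>+x. U x * indicator A x \<partial>Lpos) = epowr (Lnorm (ennreal q1) A u1) q1"
  using q1 by (simp add: U_def Lnorm_real epowr_epowr nn_integral_lebesgue_on_subset[OF assms])

sublocale copson_weight U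
proof
  show "U \<in> borel_measurable Lpos" unfolding U_def[abs_def] by measurable
  fix t :: real assume t: "0 < t"
  then have "0 < Lnorm (ennreal q1) {0<..<t} u1" "Lnorm (ennreal q1) {0<..<t} u1 < top"
    using u1 by (auto simp: cOmega_def)
  then show "0 < (\<integral>\<^sup>+x. U x * indicator {0<..<t} x \<partial>Lpos)" "(\<integral>\<^sup>+x. U x * indicator {0<..<t} x \<partial>Lpos) < top"
    by (simp_all add: nn_integral_U subset_eq zero_less_iff_neq_zero)
qed

abbreviation "P \<equiv> p1 / p2"
abbreviation "Q \<equiv> q1 / p2"

lemma PQ: "1 \<le> P" "0 < P" "0 < Q"
  using p2 p12 q1 by auto

definition U2 :: "real \<Rightarrow> ennreal" where "U2 x = Lnorm (ennreal p2) {x<..} u2"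
definition v :: "real \<Rightarrow> ennreal" where "v x = inverse (v1 x) * v2 x"
definition W :: "real \<Rightarrow> ennreal" where "W x = epowr (U2 x * v x) p2"

lemma epowr_U2:
  assumes "0 < x" shows "epowr (U2 x) p2 = (\<integral>\<^sup>+y. epowr (u2 y) p2 * indicator {x<..} y \<partial>Lpos)"
  using p2 assms nn_integral_lebesgue_on_subset[of "{x<..}" "\<lambda>y. epowr (u2 y) p2"]
  by (simp add: U2_def Lnorm_real epowr_epowr)

text \<open>A parameter integral of a jointly measurable function: the indicator of (x,oo) is
  written as a condition on the pair (x,y), and \<sigma>-finiteness of Lebesgue measure on (0,oo)
  gives measurability in x.\<close>

lemma measurable_U2 [measurable]: "U2 \<in> borel_measurable Lpos"
proof -
  interpret sigma_finite_measure Lpos by (rule sigma_finite_Lpos)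
  have "U2 x = epowr (\<integral>\<^sup>+y. epowr (u2 y) p2 * (if x < y then 1 else 0) \<partial>Lpos) (1 / p2)"
    if "x \<in> space Lpos" for x
  proof -
    have "0 < x" using that by (simp add: space_restrict_space)
    from epowr_U2[OF this] have "(\<integral>\<^sup>+y. epowr (u2 y) p2 * (if x < y then 1 else 0) \<partial>Lpos) = epowr (U2 x) p2"
      by (simp add: indicator_def of_bool_def)
    then show ?thesis using p2 by (simp add: epowr_epowr)
  qed
  then show ?thesis by (subst measurable_cong) auto
qed

lemma measurable_v [measurable]: "v \<in> borel_measurable Lpos"
  unfolding v_def[abs_def] by measurable

lemma measurable_W [measurable]: "W \<in> borel_measurable Lpos"
  unfolding W_def[abs_def] by measurable

lemma AE_v1: "AE x in Lpos. 0 < v1 x \<and> v1 x < top"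
  and AE_v2: "AE x in Lpos. v2 x < top"
  using v1 v2 by (auto simp: weights_def)

lemma U2_finite: "0 < x \<Longrightarrow> U2 x < top"
  using u2 by (auto simp: Omega_def U2_def)

lemma AE_W: "AE x in Lpos. U2 x * v x < top"
proof -
  have "AE x in Lpos. x \<in> space Lpos" by (rule AE_space)
  then show ?thesis
    using AE_v1 AE_v2
  proof eventually_elim
    case (elim x)
    then have "inverse (v1 x) < top" by (auto simp: less_top[symmetric])
    then show ?case
      using elim U2_finite[of x] by (auto simp: v_def ennreal_mult_less_top space_restrict_space)
  qed
qed

lemma dual_norm_W:
  assumes "A \<in> sets lebesgue" "A \<subseteq> {0<..}"
  shows "dual_norm Lpos P W A
    = epowr (wLnorm (exp_to (ennreal p1) (ennreal p2)) v A U2) p2"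
  unfolding W_def[abs_def] wLnorm_def
  by (rule dual_norm_eq_Lnorm[OF assms p2 p12 _ AE_W]) measurable

text \<open>F and f are related almost everywhere and not pointwise, because recovering f from F
  divides by v1, which succeeds only where 0 < v1 < oo.\<close>

lemma Cop_norm_eq:
  assumes F: "AE x in Lpos. F x = epowr (f x * v1 x) p2"
  shows "Cop_norm (ennreal p1) (ennreal q1) u1 v1 f = epowr (copson P Q F) (1 / q1)"
proof -
  have p1: "0 < p1" using p2 p12 by simp
  have tail: "epowr (Lnorm (ennreal p1) {x<..} (\<lambda>y. f y * v1 y)) q1 = epowr (tail P F x) (Q / P)"
    if x: "x \<in> space Lpos" for x
  proof -
    have "(\<integral>\<^sup>+y. epowr (f y * v1 y) p1 * indicator {x<..} y \<partial>Lpos) = tail P F x"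
      unfolding tail_def using F p2
      by (intro nn_integral_cong_AE) (auto elim!: eventually_mono simp: epowr_epowr)
    moreover have "(\<integral>\<^sup>+y. epowr (f y * v1 y) p1 \<partial>lebesgue_on {x<..})
        = (\<integral>\<^sup>+y. epowr (f y * v1 y) p1 * indicator {x<..} y \<partial>Lpos)"
      using x by (intro nn_integral_lebesgue_on_subset) (auto simp: space_restrict_space)
    ultimately have "Lnorm (ennreal p1) {x<..} (\<lambda>y. f y * v1 y) = epowr (tail P F x) (1 / p1)"
      by (simp only: Lnorm_real[OF p1])
    moreover have "1 / p1 * q1 = Q / P" using p2 by simp
    ultimately show ?thesis by (simp only: epowr_epowr)
  qed
  have "(\<integral>\<^sup>+x. epowr (Lnorm (ennreal p1) {x<..} (\<lambda>y. f y * v1 y) * u1 x) q1 \<partial>Lpos) = copson P Q F"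
    unfolding copson_def
    by (intro nn_integral_cong) (simp add: epowr_mult tail U_def mult.commute)
  then show ?thesis
    using q1 by (simp add: Cop_norm_def wLnorm_def Lnorm_real)
qed

text \<open>Exchanging the order of integration leaves (f v2)^p2 at y times the integral of u2^p2
  over (y,oo), which is the p2-th power of U2(y).\<close>

lemma Ces_norm_eq:
  assumes [measurable]: "f \<in> borel_measurable Lpos"
    and F: "AE x in Lpos. F x = epowr (f x * v1 x) p2"
  shows "Ces_norm (ennreal p2) (ennreal p2) u2 v2 f = epowr (\<integral>\<^sup>+x. F x * W x \<partial>Lpos) (1 / p2)"
proof -
  interpret sigma_finite_measure Lpos by (rule sigma_finite_Lpos)
  interpret pair_sigma_finite Lpos Lpos ..
  let ?g = "\<lambda>y. epowr (f y * v2 y) p2"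
  have "(\<integral>\<^sup>+x. epowr (Lnorm (ennreal p2) {0<..<x} (\<lambda>y. f y * v2 y) * u2 x) p2 \<partial>Lpos)
      = (\<integral>\<^sup>+x. (\<integral>\<^sup>+y. ?g y * indicator {0<..<x} y * epowr (u2 x) p2 \<partial>Lpos) \<partial>Lpos)"
  proof (rule nn_integral_cong)
    fix x
    have "epowr (Lnorm (ennreal p2) {0<..<x} (\<lambda>y. f y * v2 y) * u2 x) p2
        = (\<integral>\<^sup>+y. ?g y * indicator {0<..<x} y \<partial>Lpos) * epowr (u2 x) p2"
      using p2 nn_integral_lebesgue_on_subset[of "{0<..<x}" ?g]
      by (simp add: Lnorm_real epowr_mult epowr_epowr subset_eq)
    also have "\<dots> = (\<integral>\<^sup>+y. ?g y * indicator {0<..<x} y * epowr (u2 x) p2 \<partial>Lpos)"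
      by (rule nn_integral_multc[symmetric]) measurable
    finally show "epowr (Lnorm (ennreal p2) {0<..<x} (\<lambda>y. f y * v2 y) * u2 x) p2 = \<dots>" .
  qed
  also have "\<dots> = (\<integral>\<^sup>+y. (\<integral>\<^sup>+x. ?g y * indicator {0<..<x} y * epowr (u2 x) p2 \<partial>Lpos) \<partial>Lpos)"
  proof (rule Fubini')
    have "(\<lambda>(y, x). ?g y * (if 0 < y \<and> y < x then 1 else 0) * epowr (u2 x) p2)
        \<in> borel_measurable (Lpos \<Otimes>\<^sub>M Lpos)"
      by measurable
    then show "(\<lambda>(y, x). ?g y * indicator {0<..<x} y * epowr (u2 x) p2) \<in> borel_measurable (Lpos \<Otimes>\<^sub>M Lpos)"
      by (simp add: indicator_def)
  qed
  also have "\<dots> = (\<integral>\<^sup>+y. F y * W y \<partial>Lpos)"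
  proof (rule nn_integral_cong_AE)
    have "AE y in Lpos. y \<in> space Lpos" by (rule AE_space)
    then show "AE y in Lpos. (\<integral>\<^sup>+x. ?g y * indicator {0<..<x} y * epowr (u2 x) p2 \<partial>Lpos) = F y * W y"
      using AE_v1 F
    proof eventually_elim
      case (elim y)
      then have y: "0 < y" by (simp add: space_restrict_space)
      have "(\<integral>\<^sup>+x. ?g y * indicator {0<..<x} y * epowr (u2 x) p2 \<partial>Lpos)
          = (\<integral>\<^sup>+x. ?g y * (epowr (u2 x) p2 * indicator {y<..} x) \<partial>Lpos)"
        using y by (intro nn_integral_cong) (auto simp: indicator_def)
      also have "\<dots> = ?g y * epowr (U2 y) p2"
        unfolding epowr_U2[OF y] by (rule nn_integral_cmult) measurable
      \<comment> \<open>Inserting v1 v1^(-1) = 1, valid a.e., converts f v2 into f v1 times v: the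
        first gives F, and v joins U2 in W.\<close>
      also have "\<dots> = epowr (v1 y * (inverse (v1 y) * (f y * v2 y * U2 y))) p2"
        using elim by (simp add: ennreal_mult_inverse_cancel epowr_mult)
      also have "\<dots> = F y * W y"
        using elim by (simp add: W_def v_def epowr_mult ac_simps)
      finally show ?case .
    qed
  qed
  finally show ?thesis
    using p2 by (simp add: Ces_norm_def wLnorm_def Lnorm_real)
qed

abbreviation "emb \<equiv> embedding_const (Cop_norm (ennreal p1) (ennreal q1) u1 v1)
  (Ces_norm (ennreal p2) (ennreal p2) u2 v2)"

section \<open>From inequalities for F to the embedding constant\<close>

lemma emb_upper:
  assumes K: "0 < K" and le: "\<And>F. F \<in> borel_measurable Lpos \<Longrightarrow> copson P Q F < top \<Longrightarrow>
      (\<integral>\<^sup>+x. F x * W x \<partial>Lpos) \<le> ennreal K * epowr A p2 * epowr (copson P Q F) (1 / Q)"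
  shows "emb \<le> ennreal (K powr (1 / p2)) * A"
  unfolding embedding_const_def
proof (rule Inf_lower, clarify)
  fix f assume "f \<in> Mplus" and fin: "Cop_norm (ennreal p1) (ennreal q1) u1 v1 f < \<infinity>"
  then have [measurable]: "f \<in> borel_measurable Lpos" by (simp add: Mplus_def)
  let ?F = "\<lambda>x. epowr (f x * v1 x) p2"
  have "copson P Q ?F < top"
    using fin by (simp add: Cop_norm_eq[of ?F])
  then have "(\<integral>\<^sup>+x. ?F x * W x \<partial>Lpos) \<le> ennreal K * epowr A p2 * epowr (copson P Q ?F) (1 / Q)"
    by (intro le) measurable
  then have "epowr (\<integral>\<^sup>+x. ?F x * W x \<partial>Lpos) (1 / p2)
      \<le> epowr (ennreal K * epowr A p2 * epowr (copson P Q ?F) (1 / Q)) (1 / p2)"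
    using p2 by (intro epowr_mono) auto
  also have "\<dots> = ennreal (K powr (1 / p2)) * A * epowr (copson P Q ?F) (1 / q1)"
    using p2 q1 K by (simp add: epowr_mult epowr_epowr epowr_ennreal)
  finally show "Ces_norm (ennreal p2) (ennreal p2) u2 v2 f
      \<le> ennreal (K powr (1 / p2)) * A * Cop_norm (ennreal p1) (ennreal q1) u1 v1 f"
    by (simp add: Cop_norm_eq[of ?F] Ces_norm_eq[of f ?F])
qed

text \<open>An admissible c is tested with f = v1^(-1) F^(1/p2), so that every F with finite
  \<open>copson\<close> comes from a member of the source space; the p2-th power of the embedding
  inequality is the inequality for F.\<close>

lemma emb_lower:
  assumes K: "0 < K" and le: "\<And>c. (\<And>F. F \<in> borel_measurable Lpos \<Longrightarrow> copson P Q F < top \<Longrightarrow>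
      (\<integral>\<^sup>+x. F x * W x \<partial>Lpos) \<le> epowr c p2 * epowr (copson P Q F) (1 / Q)) \<Longrightarrow> B \<le> ennreal K * c"
  shows "ennreal (1 / K) * B \<le> emb"
  unfolding embedding_const_def
proof (rule Inf_greatest, clarify)
  fix c assume c: "\<forall>f\<in>{f \<in> Mplus. Cop_norm (ennreal p1) (ennreal q1) u1 v1 f < \<infinity>}.
    Ces_norm (ennreal p2) (ennreal p2) u2 v2 f \<le> c * Cop_norm (ennreal p1) (ennreal q1) u1 v1 f"
  have "B \<le> ennreal K * c"
  proof (rule le)
    fix F assume [measurable]: "F \<in> borel_measurable Lpos" and fin: "copson P Q F < top"
    define f where "f x = inverse (v1 x) * epowr (F x) (1 / p2)" for x
    have [measurable]: "f \<in> borel_measurable Lpos" unfolding f_def[abs_def] by measurable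
    have F: "AE x in Lpos. F x = epowr (f x * v1 x) p2"
      using AE_v1
    proof eventually_elim
      case (elim x)
      then have "f x * v1 x = epowr (F x) (1 / p2)"
        unfolding f_def using ennreal_mult_inverse_cancel[of "v1 x" "epowr (F x) (1 / p2)"]
        by (simp add: mult.commute)
      then show ?case using p2 by (simp add: epowr_epowr)
    qed
    have "f \<in> Mplus" by (simp add: Mplus_def)
    moreover have "Cop_norm (ennreal p1) (ennreal q1) u1 v1 f < \<infinity>"
      using fin by (simp add: Cop_norm_eq[OF F])
    ultimately have "Ces_norm (ennreal p2) (ennreal p2) u2 v2 f \<le> c * Cop_norm (ennreal p1) (ennreal q1) u1 v1 f"
      using c by blast
    then have "epowr (\<integral>\<^sup>+x. F x * W x \<partial>Lpos) (1 / p2) \<le> c * epowr (copson P Q F) (1 / q1)"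
      by (simp add: Cop_norm_eq[OF F] Ces_norm_eq[OF _ F])
    then have "(\<integral>\<^sup>+x. F x * W x \<partial>Lpos) \<le> epowr (c * epowr (copson P Q F) (1 / q1)) p2"
      using le_epowr_swap[OF p2] by blast
    then show "(\<integral>\<^sup>+x. F x * W x \<partial>Lpos) \<le> epowr c p2 * epowr (copson P Q F) (1 / Q)"
      by (simp add: epowr_mult epowr_epowr)
  qed
  then have "ennreal (1 / K) * B \<le> ennreal (1 / K) * (ennreal K * c)" by (rule mult_left_mono) simp
  also have "\<dots> = c" using K by (simp flip: mult.assoc ennreal_mult)
  finally show "ennreal (1 / K) * B \<le> c" .
qed

section \<open>Translation to the quantities of the statement\<close>

abbreviation "wnorm A \<equiv> wLnorm (exp_to (ennreal p1) (ennreal p2)) v A U2"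
abbreviation "unorm A \<equiv> Lnorm (ennreal q1) A u1"

lemma unorm_eq: "unorm {0<..<t} = epowr (ennreal (V t)) (1 / q1)"
  unfolding nn_integral_Ioo[symmetric] using q1 by (subst nn_integral_U) (auto simp: epowr_epowr)

lemma unorm_pos: "0 < t \<Longrightarrow> 0 < unorm {0<..<t}" "unorm {0<..<t} < top"
  using V_pos[of t] by (auto simp: unorm_eq zero_less_iff_neq_zero)

lemma dual_norm_le_iff:
  "dual_norm Lpos P W {0<..<t} \<le> epowr c p2 * epowr (ennreal (V t)) (1 / Q)
    \<longleftrightarrow> wnorm {0<..<t} \<le> c * unorm {0<..<t}"
proof -
  have "epowr c p2 * epowr (ennreal (V t)) (1 / Q) = epowr (c * unorm {0<..<t}) p2"
    using p2 by (simp add: unorm_eq epowr_mult epowr_epowr)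
  moreover have "dual_norm Lpos P W {0<..<t} = epowr (wnorm {0<..<t}) p2"
    by (rule dual_norm_W) auto
  ultimately show ?thesis using epowr_le_iff[OF p2] by simp
qed

text \<open>The lower bound has constant 1, as each t is a single-interval test with the same c. The
  upper constant 4^(1/Q) is replaced by its p2-th root on leaving the scale of F.\<close>

lemma emb_equiv_le:
  assumes "q1 \<le> p2"
  shows "equiv_up_to (max 1 ((4 powr (1 / Q)) powr (1 / p2))) emb
    (SUP t\<in>{0<..}. inverse (unorm {0<..<t}) * wnorm {0<..<t})" (is "equiv_up_to _ _ ?A")
proof (rule equiv_up_toI)
  show "emb \<le> ennreal ((4 powr (1 / Q)) powr (1 / p2)) * ?A"
  proof (rule emb_upper)
    fix F assume [measurable]: "F \<in> borel_measurable Lpos" and fin: "copson P Q F < top"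
    show "(\<integral>\<^sup>+x. F x * W x \<partial>Lpos) \<le> ennreal (4 powr (1 / Q)) * epowr ?A p2 * epowr (copson P Q F) (1 / Q)"
    proof (rule copson_upper_le_1[OF PQ(2,3) _ fin])
      fix t :: real assume t: "0 < t"
      then have "inverse (unorm {0<..<t}) * wnorm {0<..<t} \<le> ?A" by (intro SUP_upper) auto
      then show "dual_norm Lpos P W {0<..<t} \<le> epowr ?A p2 * epowr (ennreal (V t)) (1 / Q)"
        unfolding dual_norm_le_iff using unorm_pos(1)[OF t] unorm_pos(2)[of t] by (simp add: inverse_mult_le_iff)
    qed (use assms p2 in auto)
  qed simp
  show "ennreal (1 / 1) * ?A \<le> emb"
  proof (rule emb_lower)
    fix c
    assume test: "\<And>F. F \<in> borel_measurable Lpos \<Longrightarrow> copson P Q F < top \<Longrightarrow>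
      (\<integral>\<^sup>+x. F x * W x \<partial>Lpos) \<le> epowr c p2 * epowr (copson P Q F) (1 / Q)"
    have "inverse (unorm {0<..<t}) * wnorm {0<..<t} \<le> c" if t: "0 < t" for t
    proof -
      have "dual_norm Lpos P W {0<..<t} \<le> epowr c p2 * epowr (ennreal (V t)) (1 / Q)"
        by (rule copson_lower_Ioo[OF PQ(2,3) measurable_W t test])
      then show ?thesis
        unfolding dual_norm_le_iff using unorm_pos(1)[OF t] unorm_pos(2)[of t] by (simp add: inverse_mult_le_iff)
    qed
    then show "?A \<le> ennreal 1 * c" by (auto intro: SUP_least)
  qed simp
qed simp_all

text \<open>V(t) is the q1-th power of the norm of u1 over (0,t), so the integrator of the
  statement, with q1 \<rightarrow> p2 = q1 s, is -V^(-s).\<close>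

lemma neg_pow_eq: "- (enn2real (unorm {0<..<t}) powr - (q1 * s)) = neg_pow s t"
  using q1 by (simp add: unorm_eq epowr_ennreal neg_pow_def powr_powr)

lemma boundary_eq:
  "epowr (inverse (unorm {0<..}) * wnorm {0<..}) p2
    = epowr (inverse (\<integral>\<^sup>+x. U x \<partial>Lpos)) (1 / Q) * dual_norm Lpos P W {0<..}"
proof -
  have "(\<integral>\<^sup>+x. U x \<partial>Lpos) = (\<integral>\<^sup>+x. U x * indicator {0<..} x \<partial>Lpos)"
    by (intro nn_integral_cong) (auto simp: space_restrict_space)
  then have "(\<integral>\<^sup>+x. U x \<partial>Lpos) = epowr (unorm {0<..}) q1"
    using nn_integral_U[of "{0<..}"] by simp
  then have "epowr (inverse (\<integral>\<^sup>+x. U x \<partial>Lpos)) (1 / Q) = epowr (inverse (unorm {0<..})) p2"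
    using q1 by (simp add: epowr_epowr flip: epowr_inverse)
  moreover have "dual_norm Lpos P W {0<..} = epowr (wnorm {0<..}) p2"
    by (rule dual_norm_W) auto
  ultimately show ?thesis by (simp add: epowr_mult)
qed

text \<open>For the upper bound, E is the p2-th power of the whole right-hand side, since each
  summand is at most the sum. For the lower bound the summands are estimated separately, by L^(1/r)
  c and by c, whence the 1 added to L^(1/r).\<close>

lemma emb_equiv_gt:
  assumes gt: "p2 < q1"
  defines "s \<equiv> 1 / (Q - 1)"
  defines "r \<equiv> q1 * s"
  defines "K \<equiv> ((1 / (1 - 2 powr - s) + 2) powr (1 / (Q * s)) * 4 powr (1 / Q))"
  defines "L \<equiv> 4 powr (Q * s) * (2 * (1 + 2 powr (Q * s) * (2 * (2 * 2 powr Q) powr (1 / Q)) powr (Q * s)))"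
  shows "equiv_up_to (max (L powr (1 / r) + 1) (K powr (1 / p2))) emb
    (epowr (\<integral>\<^sup>+t. epowr (wnorm {0<..<t}) r \<partial>stieltjes (neg_pow s)) (1 / r) + inverse (unorm {0<..}) * wnorm {0<..})"
    (is "equiv_up_to _ _ (epowr ?I _ + ?b)")
proof -
  have Q: "1 < Q" using gt p2 by simp
  then have s: "0 < s" by (simp add: s_def)
  have r: "0 < r" "p2 * (Q * s) = r" using s p2 q1 by (auto simp: r_def)
  have L: "0 < L" by (simp add: L_def add_pos_nonneg)
  have K: "0 < K"
  proof -
    have "2 powr - s < (1::real)" using s by (simp add: powr_less_one)
    then have "0 < 1 / (1 - 2 powr - s) + (2::real)" by (intro add_pos_pos) auto
    then show ?thesis by (simp add: K_def)
  qed
  have I: "(\<integral>\<^sup>+t. epowr (dual_norm Lpos P W {0<..<t}) (Q * s) \<partial>stieltjes (neg_pow s)) = ?I"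
  proof (rule nn_integral_cong)
    fix t
    have "dual_norm Lpos P W {0<..<t} = epowr (wnorm {0<..<t}) p2" by (rule dual_norm_W) auto
    then show "epowr (dual_norm Lpos P W {0<..<t}) (Q * s) = epowr (wnorm {0<..<t}) r"
      by (simp only: epowr_epowr r)
  qed
  show ?thesis
  proof (rule equiv_up_toI)
    let ?B = "epowr ?I (1 / r) + ?b"
    show "emb \<le> ennreal (K powr (1 / p2)) * ?B"
    proof (rule emb_upper[OF K])
      fix F assume F: "F \<in> borel_measurable Lpos" and fin: "copson P Q F < top"
      show "(\<integral>\<^sup>+x. F x * W x \<partial>Lpos) \<le> ennreal K * epowr ?B p2 * epowr (copson P Q F) (1 / Q)"
        unfolding K_def
      proof (rule copson_upper_gt_1[OF PQ(2) Q s_def[THEN meta_eq_to_obj_eq] fin F measurable_W])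
        have "epowr ?I (1 / r) \<le> ?B" by simp
        then have "?I \<le> epowr ?B r" using le_epowr_swap[OF r(1)] by blast
        then show "(\<integral>\<^sup>+t. epowr (dual_norm Lpos P W {0<..<t}) (Q * s) \<partial>stieltjes (neg_pow s))
            \<le> epowr (epowr ?B p2) (Q * s)"
          by (simp only: I epowr_epowr r)
        have "epowr ?b p2 \<le> epowr ?B p2" using p2 by (intro epowr_mono) auto
        then show "epowr (inverse (\<integral>\<^sup>+x. U x \<partial>Lpos)) (1 / Q) * dual_norm Lpos P W {0<..} \<le> epowr ?B p2"
          by (simp only: boundary_eq)
      qed
    qed
    show "ennreal (1 / (L powr (1 / r) + 1)) * ?B \<le> emb"
    proof (rule emb_lower)
      fix c
      assume test: "\<And>F. F \<in> borel_measurable Lpos \<Longrightarrow> copson P Q F < top \<Longrightarrow>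
        (\<integral>\<^sup>+x. F x * W x \<partial>Lpos) \<le> epowr c p2 * epowr (copson P Q F) (1 / Q)"
      have "?I \<le> ennreal L * epowr (epowr c p2) (Q * s)"
        unfolding I[symmetric] L_def
        by (rule copson_lower_gt_1[OF PQ(1) Q s_def[THEN meta_eq_to_obj_eq] measurable_W test])
      also have "\<dots> = epowr (ennreal (L powr (1 / r)) * c) r"
        using r L by (simp add: epowr_mult epowr_epowr epowr_ennreal powr_powr)
      finally have "epowr ?I (1 / r) \<le> ennreal (L powr (1 / r)) * c"
        by (simp only: le_epowr_swap[OF r(1)])
      moreover have "?b \<le> c"
      proof -
        have "epowr ?b p2 \<le> epowr c p2"
          unfolding boundary_eq by (rule copson_lower_boundary[OF PQ(2,3) measurable_W test])
        then show ?thesis using epowr_le_iff[OF p2] by blast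
      qed
      ultimately have "?B \<le> ennreal (L powr (1 / r)) * c + c" by (rule add_mono)
      also have "\<dots> = ennreal (L powr (1 / r) + 1) * c"
        by (simp add: distrib_right)
      finally show "?B \<le> ennreal (L powr (1 / r) + 1) * c" .
    qed (simp add: add_nonneg_pos)
  qed (use K in \<open>simp_all add: add_nonneg_pos\<close>)
qed

end

theorem theorem7p4:
  fixes p1 p2 q1 q2 :: ennreal
  assumes "0 < p1" "p1 < \<infinity>" "0 < p2" "p2 < \<infinity>" "0 < q1" "q1 < \<infinity>" "0 < q2" "q2 < \<infinity>"
    and "p1 \<noteq> q1" and "p2 = q2" and "p2 \<le> p1"
  shows
    "(q1 \<le> p2 \<longrightarrow>
      (\<exists>c>0. \<forall>v1\<in>weights. \<forall>v2\<in>weights. \<forall>u1\<in>cOmega q1. \<forall>u2\<in>Omega q2.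
        let v = (\<lambda>x. inverse (v1 x) * v2 x) in
        equiv_up_to c
          (embedding_const (Cop_norm p1 q1 u1 v1) (Ces_norm p2 q2 u2 v2))
          (SUP t\<in>{0<..}. inverse (Lnorm q1 {0<..<t} u1) *
             wLnorm (exp_to p1 p2) v {0<..<t} (\<lambda>x. Lnorm p2 {x<..} u2)))) \<and>
     (p2 < q1 \<longrightarrow>
      (\<exists>c>0. \<forall>v1\<in>weights. \<forall>v2\<in>weights. \<forall>u1\<in>cOmega q1. \<forall>u2\<in>Omega q2.
        let v = (\<lambda>x. inverse (v1 x) * v2 x);
            r = enn2real (exp_to q1 p2);
            h = (\<lambda>t. - (enn2real (Lnorm q1 {0<..<t} u1) powr (- r)))
        in
        equiv_up_to c
          (embedding_const (Cop_norm p1 q1 u1 v1) (Ces_norm p2 q2 u2 v2))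
          (epowr (\<integral>\<^sup>+t. epowr (wLnorm (exp_to p1 p2) v {0<..<t} (\<lambda>x. Lnorm p2 {x<..} u2)) r
                     \<partial>stieltjes h) (1 / r) +
           inverse (Lnorm q1 {0<..} u1) *
             wLnorm (exp_to p1 p2) v {0<..} (\<lambda>x. Lnorm p2 {x<..} u2))))"
proof -
  define a b d where "a = enn2real p1" and "b = enn2real p2" and "d = enn2real q1"
  have abd: "p1 = ennreal a" "p2 = ennreal b" "q1 = ennreal d" "q2 = ennreal b"
    using assms by (auto simp: a_def b_def d_def)
  have pos: "0 < b" "b \<le> a" "0 < d"
    using assms abd by (auto simp: ennreal_less_zero_iff ennreal_le_iff2)
  have locI: "copson_cesaro a b d v1 v2 u1 u2"
    if "v1 \<in> weights" "v2 \<in> weights" "u1 \<in> cOmega (ennreal d)" "u2 \<in> Omega (ennreal b)" for v1 v2 u1 u2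
    using that pos by unfold_locales
  show ?thesis
    unfolding abd
  proof (intro conjI impI)
    assume "ennreal d \<le> ennreal b"
    then have db: "d \<le> b" using pos by (simp add: ennreal_le_iff)
    show "\<exists>c>0. \<forall>v1\<in>weights. \<forall>v2\<in>weights. \<forall>u1\<in>cOmega (ennreal d). \<forall>u2\<in>Omega (ennreal b).
        let v = (\<lambda>x. inverse (v1 x) * v2 x) in
        equiv_up_to c
          (embedding_const (Cop_norm (ennreal a) (ennreal d) u1 v1) (Ces_norm (ennreal b) (ennreal b) u2 v2))
          (SUP t\<in>{0<..}. inverse (Lnorm (ennreal d) {0<..<t} u1) *
             wLnorm (exp_to (ennreal a) (ennreal b)) v {0<..<t} (\<lambda>x. Lnorm (ennreal b) {x<..} u2))"
    proof (intro exI conjI ballI)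
      fix v1 v2 u1 u2
      assume "v1 \<in> weights" "v2 \<in> weights" "u1 \<in> cOmega (ennreal d)" "u2 \<in> Omega (ennreal b)"
      then interpret copson_cesaro a b d v1 v2 u1 u2 by (rule locI)
      show "let v = (\<lambda>x. inverse (v1 x) * v2 x) in
        equiv_up_to (max 1 ((4 powr (1 / (d / b))) powr (1 / b)))
          (embedding_const (Cop_norm (ennreal a) (ennreal d) u1 v1) (Ces_norm (ennreal b) (ennreal b) u2 v2))
          (SUP t\<in>{0<..}. inverse (Lnorm (ennreal d) {0<..<t} u1) *
             wLnorm (exp_to (ennreal a) (ennreal b)) v {0<..<t} (\<lambda>x. Lnorm (ennreal b) {x<..} u2))"
        using emb_equiv_le[OF db] unfolding Let_def v_def[abs_def] U2_def[abs_def] .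
    qed simp
  next
    assume "ennreal b < ennreal d"
    then have bd: "b < d" using pos by (simp add: ennreal_less_iff)
    \<comment> \<open>With this s, the product d s = d b/(d - b) is the real form of q1
      \<rightarrow> p2.\<close>
    define s where "s = 1 / (d / b - 1)"
    have r: "enn2real (exp_to (ennreal d) (ennreal b)) = d * s"
      using exp_to_ennreal[OF pos(1) bd] pos bd by (simp add: s_def field_simps)
    show "\<exists>c>0. \<forall>v1\<in>weights. \<forall>v2\<in>weights. \<forall>u1\<in>cOmega (ennreal d). \<forall>u2\<in>Omega (ennreal b).
        let v = (\<lambda>x. inverse (v1 x) * v2 x);
            r = enn2real (exp_to (ennreal d) (ennreal b));
            h = (\<lambda>t. - (enn2real (Lnorm (ennreal d) {0<..<t} u1) powr (- r)))
        in
        equiv_up_to c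
          (embedding_const (Cop_norm (ennreal a) (ennreal d) u1 v1) (Ces_norm (ennreal b) (ennreal b) u2 v2))
          (epowr (\<integral>\<^sup>+t. epowr (wLnorm (exp_to (ennreal a) (ennreal b)) v {0<..<t} (\<lambda>x. Lnorm (ennreal b) {x<..} u2)) r
                     \<partial>stieltjes h) (1 / r) +
           inverse (Lnorm (ennreal d) {0<..} u1) *
             wLnorm (exp_to (ennreal a) (ennreal b)) v {0<..} (\<lambda>x. Lnorm (ennreal b) {x<..} u2))"
      (is "\<exists>c>0. ?Prop c")
    proof -
      \<comment> \<open>The constant is spelled out before any weight is introduced, so that it
        depends on the exponents alone.\<close>
      define c where "c = max ((4 powr (d / b * s) * (2 * (1 + 2 powr (d / b * s) *
          (2 * (2 * 2 powr (d / b)) powr (1 / (d / b))) powr (d / b * s)))) powr (1 / (d * s)) + 1)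
        (((1 / (1 - 2 powr - s) + 2) powr (1 / (d / b * s)) * 4 powr (1 / (d / b))) powr (1 / b))"
      have "0 < c" unfolding c_def by (simp add: less_max_iff_disj add_nonneg_pos)
      moreover have "?Prop c"
      proof (intro ballI)
        fix v1 v2 u1 u2
        assume "v1 \<in> weights" "v2 \<in> weights" "u1 \<in> cOmega (ennreal d)" "u2 \<in> Omega (ennreal b)"
        then interpret copson_cesaro a b d v1 v2 u1 u2 by (rule locI)
        show "let v = (\<lambda>x. inverse (v1 x) * v2 x);
            r = enn2real (exp_to (ennreal d) (ennreal b));
            h = (\<lambda>t. - (enn2real (Lnorm (ennreal d) {0<..<t} u1) powr (- r)))
          in
          equiv_up_to c
          (embedding_const (Cop_norm (ennreal a) (ennreal d) u1 v1) (Ces_norm (ennreal b) (ennreal b) u2 v2))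
          (epowr (\<integral>\<^sup>+t. epowr (wLnorm (exp_to (ennreal a) (ennreal b)) v {0<..<t} (\<lambda>x. Lnorm (ennreal b) {x<..} u2)) r
                     \<partial>stieltjes h) (1 / r) +
           inverse (Lnorm (ennreal d) {0<..} u1) *
             wLnorm (exp_to (ennreal a) (ennreal b)) v {0<..} (\<lambda>x. Lnorm (ennreal b) {x<..} u2))"
          unfolding Let_def r neg_pow_eq c_def
          using emb_equiv_gt[OF bd, folded s_def] unfolding v_def[abs_def] U2_def[abs_def] .
      qed
      ultimately show ?thesis by blast
    qed
  qed
qed

end
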